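(* Consider a gas with specific internal energy $$E(\tau,S)=f(S)\int_{\ln(\tau+1)}^{+\infty}k^2(y)\,dy,\qquad \tau>0,\ S\in\mathbb{R},$$ where $f:\mathbb{R}\to\mathbb{R}$ is $C^2$ with $$f>0,\quad f'>0,\quad f''\ge0,\quad \lim_{S\to\infty}f(S)=\infty,\quad \lim_{S\to-\infty}f(S)=0,$$ and $k:(0,\infty)\to\mathbb{R}$ is $C^2$ with $$k>0,\quad k'<0,\quad k''>0,\quad \int_1^{\infty}k^2(y)\,dy<\infty,\quad \int_1^\infty k(y)\,dy=\infty,$$ $$k(y)\to\infty\ \text{ and }\ \frac{k'(y)}{k(y)}\to-\infty\quad\text{as }y\to0^+.$$ Then for all Riemann data $(\rho_l,u_l,S_l),(\rho_r,u_r,S_r)\in(0,\infty)\times\mathbb{R}\times\mathbb{R}$ the Riemann problem for the Euler equations has a unique global solution, and this solution does not contain the vacuum state. Moreover, $E$ satisfies the following constraints, where $p=-E_\tau$ and $T=E_S$: 1. $E\in C^2$ on $(0,\infty)\times\mathbb{R}$; 2. $p>0$ and $T\ge0$ (that is, $E_\tau<0$ and $E_S\ge0$); 3. $\lim_{\tau\to\infty}E(\tau,S)=0$ for each $S$, and $E>0$; 4. $E_{\tau\tau}=-p_\tau>0$ and $E_{SS}=T_S\ge0$; 5. $\int_1^\infty p(\tau,S)\,d\tau<\infty$ for all $S$, with $E(\tau,S)=\int_\tau^\infty p(\tau',S)\,d\tau'$.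
   Context: **Equations.** The Euler equations in one space dimension are $$\rho_t+(\rho u)_x=0,\qquad (\rho u)_t+(\rho u^2+p)_x=0,\qquad (\tfrac12\rho u^2+\rho E)_t+(u(\tfrac12\rho u^2+\rho E+p))_x=0,$$ with density $\rho$, specific volume $\tau=1/\rho$, velocity $u$, specific entropy $S$, specific internal energy $E=E(\tau,S)$, pressure $p=-E_\tau$ and temperature $T=E_S$. Write $\hat p(\rho,S)=p(1/\rho,S)$; the sound speed is $c=\sqrt{\hat p_\rho}$. Define $R(\rho,S)=\int_1^{\rho}\frac{\sqrt{\hat p_\rho(r,S)}}{r}\,dr$. **Elementary waves.** States are $(\rho,u,S)$. For a jump, $[g]=g_{\rm right}-g_{\rm left}$ and $\overline g$ is the average of the left and right values. The state ahead of a backward wave is its left state, and the state ahead of a forward wave is its right state; the other state is the behind state. - Backward rarefaction with left (ahead) state $(\rho_l,u_l,S_l)$: states $(\rho,u,S)$ with $S=S_l$, $\rho<\rho_l$, $u-u_l=R(\rho_l,S_l)-R(\rho,S_l)$. - Forward rarefaction with right (ahead) state $(\rho_r,u_r,S_r)$: states with $S=S_r$, $\rho<\rho_r$, $u_r-u=R(\rho_r,S_r)-R(\rho,S_r)$. - Backward or forward shock: $[E]+\overline p\,[\tau]=0$, $[u]=-\sqrt{-[p][\tau]}$, with pressure and density strictly larger behind than ahead. - Contact discontinuity: $[u]=0$, $[p]=0$. **Riemann problem.** The Riemann problem is the Cauchy problem with data equal to a constant state $U_l=(\rho_l,u_l,S_l)$ for $x<0$ and a constant state $U_r=(\rho_r,u_r,S_r)$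 for $x>0$, with $\rho_l,\rho_r>0$. A Riemann solution is one of the following. (i) Without vacuum: a pair of intermediate states $U_1,U_2$ of positive density such that $U_l,U_1$ are joined by a backward shock or rarefaction (or are equal), $U_1,U_2$ by a contact (or are equal), and $U_2,U_r$ by a forward shock or rarefaction (or are equal). (ii) Containing a vacuum: a backward rarefaction with left state $U_l$ along which $\rho$ decreases to $0$, and a forward rarefaction with right state $U_r$ along which (from right to left) $\rho$ decreases to $0$, separated by a vacuum region $\rho=0$; the velocity is required to be finite and nondecreasing in $x$, so that the limiting velocities $u_l^*$, $u_r^*$ of the two rarefactions as $\rho\to0$ are finite and satisfy $u_l\le u_l^*\le u_r^*\le u_r$. Existence and uniqueness are understood within this class of solutions. *)

theory Defs
  imports "HOL-Analysis.Analysis"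
begin

text \<open>
  An equation of state is a function \<open>E \<tau> S\<close> of specific volume and specific entropy. Only its
  values at \<open>\<tau> > 0\<close> are meaningful.
\<close>

definition C2_on :: "(real \<Rightarrow> real) \<Rightarrow> real set \<Rightarrow> bool" where
  "C2_on g A \<longleftrightarrow> g C1_differentiable_on A \<and> deriv g C1_differentiable_on A"

definition partial1 :: "(real \<Rightarrow> real \<Rightarrow> real) \<Rightarrow> real \<Rightarrow> real \<Rightarrow> real" where
  "partial1 F x y = deriv (\<lambda>t. F t y) x"

definition partial2 :: "(real \<Rightarrow> real \<Rightarrow> real) \<Rightarrow> real \<Rightarrow> real \<Rightarrow> real" where
  "partial2 F x y = deriv (\<lambda>t. F x t) y"

text \<open>For open \<open>A\<close>: all partial derivatives up to the given order exist and are continuous on \<open>A\<close>.\<close>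

definition plane_C1_on :: "(real \<Rightarrow> real \<Rightarrow> real) \<Rightarrow> (real \<times> real) set \<Rightarrow> bool" where
  "plane_C1_on F A \<longleftrightarrow>
     (\<forall>(x, y)\<in>A. (\<lambda>t. F t y) field_differentiable at x \<and> (\<lambda>t. F x t) field_differentiable at y) \<and>
     continuous_on A (\<lambda>(x, y). F x y) \<and>
     continuous_on A (\<lambda>(x, y). partial1 F x y) \<and>
     continuous_on A (\<lambda>(x, y). partial2 F x y)"

definition plane_C2_on :: "(real \<Rightarrow> real \<Rightarrow> real) \<Rightarrow> (real \<times> real) set \<Rightarrow> bool" where
  "plane_C2_on F A \<longleftrightarrow>
     plane_C1_on F A \<and> plane_C1_on (partial1 F) A \<and> plane_C1_on (partial2 F) A"

definition pressure :: "(real \<Rightarrow> real \<Rightarrow> real) \<Rightarrow> real \<Rightarrow> real \<Rightarrow> real" where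
  "pressure E \<tau> S = - partial1 E \<tau> S"

definition temperature :: "(real \<Rightarrow> real \<Rightarrow> real) \<Rightarrow> real \<Rightarrow> real \<Rightarrow> real" where
  "temperature E \<tau> S = partial2 E \<tau> S"

definition pressure_hat :: "(real \<Rightarrow> real \<Rightarrow> real) \<Rightarrow> real \<Rightarrow> real \<Rightarrow> real" where
  "pressure_hat E \<rho> S = pressure E (1 / \<rho>) S"

definition sound_speed :: "(real \<Rightarrow> real \<Rightarrow> real) \<Rightarrow> real \<Rightarrow> real \<Rightarrow> real" where
  "sound_speed E \<rho> S = sqrt (partial1 (pressure_hat E) \<rho> S)"

text \<open>The interval integral is oriented, so this is the intended value also for \<open>\<rho> < 1\<close>.\<close>

definition rarefaction_integral :: "(real \<Rightarrow> real \<Rightarrow> real) \<Rightarrow> real \<Rightarrow> real \<Rightarrow> real" where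
  "rarefaction_integral E \<rho> S = (LBINT r=ereal 1..ereal \<rho>. sound_speed E r S / r)"

datatype gas_state = State (dens: real) (vel: real) (ent: real)

definition volume_at :: "gas_state \<Rightarrow> real" where
  "volume_at U = 1 / dens U"

definition energy_at :: "(real \<Rightarrow> real \<Rightarrow> real) \<Rightarrow> gas_state \<Rightarrow> real" where
  "energy_at E U = E (volume_at U) (ent U)"

definition pressure_at :: "(real \<Rightarrow> real \<Rightarrow> real) \<Rightarrow> gas_state \<Rightarrow> real" where
  "pressure_at E U = pressure E (volume_at U) (ent U)"

definition jump :: "(gas_state \<Rightarrow> real) \<Rightarrow> gas_state \<Rightarrow> gas_state \<Rightarrow> real" where
  "jump g U V = g V - g U"

definition average :: "(gas_state \<Rightarrow> real) \<Rightarrow> gas_state \<Rightarrow> gas_state \<Rightarrow> real" where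
  "average g U V = (g U + g V) / 2"

text \<open>
  In all wave relations the first state is the left one and the second the right one. Hence the
  state ahead is the first argument for backward waves and the second for forward waves.
\<close>

definition backward_rarefaction ::
  "(real \<Rightarrow> real \<Rightarrow> real) \<Rightarrow> gas_state \<Rightarrow> gas_state \<Rightarrow> bool" where
  "backward_rarefaction E Ul U \<longleftrightarrow> ent U = ent Ul \<and> dens U < dens Ul \<and>
     vel U - vel Ul =
       rarefaction_integral E (dens Ul) (ent Ul) - rarefaction_integral E (dens U) (ent Ul)"

definition forward_rarefaction ::
  "(real \<Rightarrow> real \<Rightarrow> real) \<Rightarrow> gas_state \<Rightarrow> gas_state \<Rightarrow> bool" where
  "forward_rarefaction E U Ur \<longleftrightarrow> ent U = ent Ur \<and> dens U < dens Ur \<and>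
     vel Ur - vel U =
       rarefaction_integral E (dens Ur) (ent Ur) - rarefaction_integral E (dens U) (ent Ur)"

definition rankine_hugoniot ::
  "(real \<Rightarrow> real \<Rightarrow> real) \<Rightarrow> gas_state \<Rightarrow> gas_state \<Rightarrow> bool" where
  "rankine_hugoniot E U V \<longleftrightarrow>
     jump (energy_at E) U V + average (pressure_at E) U V * jump volume_at U V = 0 \<and>
     jump vel U V = - sqrt (- (jump (pressure_at E) U V * jump volume_at U V))"

definition backward_shock ::
  "(real \<Rightarrow> real \<Rightarrow> real) \<Rightarrow> gas_state \<Rightarrow> gas_state \<Rightarrow> bool" where
  "backward_shock E Ul U \<longleftrightarrow> rankine_hugoniot E Ul U \<and>
     pressure_at E U > pressure_at E Ul \<and> dens U > dens Ul"

definition forward_shock ::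
  "(real \<Rightarrow> real \<Rightarrow> real) \<Rightarrow> gas_state \<Rightarrow> gas_state \<Rightarrow> bool" where
  "forward_shock E U Ur \<longleftrightarrow> rankine_hugoniot E U Ur \<and>
     pressure_at E U > pressure_at E Ur \<and> dens U > dens Ur"

definition contact ::
  "(real \<Rightarrow> real \<Rightarrow> real) \<Rightarrow> gas_state \<Rightarrow> gas_state \<Rightarrow> bool" where
  "contact E U V \<longleftrightarrow> jump vel U V = 0 \<and> jump (pressure_at E) U V = 0"

text \<open>
  A solution without vacuum is given by its two intermediate states. In a solution with vacuum
  both rarefactions are complete, hence determined by the data; it is recorded by the limiting
  velocities at the left and right edges of the vacuum.
\<close>

datatype riemann_pattern = No_Vacuum gas_state gas_state | Vacuum real real

fun contains_vacuum :: "riemann_pattern \<Rightarrow> bool" where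
  "contains_vacuum (No_Vacuum U1 U2) = False"
| "contains_vacuum (Vacuum ul ur) = True"

text \<open>
  In the second equation, the functions of \<open>\<rho>\<close> are the velocities along the backward rarefaction
  from \<open>Ul\<close> and along the forward rarefaction from \<open>Ur\<close>. The limit to a real number says that
  the edge velocity is finite.
\<close>

fun riemann_solution ::
  "(real \<Rightarrow> real \<Rightarrow> real) \<Rightarrow> gas_state \<Rightarrow> gas_state \<Rightarrow> riemann_pattern \<Rightarrow> bool" where
  "riemann_solution E Ul Ur (No_Vacuum U1 U2) \<longleftrightarrow>
     dens U1 > 0 \<and> dens U2 > 0 \<and>
     (backward_shock E Ul U1 \<or> backward_rarefaction E Ul U1 \<or> Ul = U1) \<and>
     (contact E U1 U2 \<or> U1 = U2) \<and>
     (forward_shock E U2 Ur \<or> forward_rarefaction E U2 Ur \<or> U2 = Ur)"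
| "riemann_solution E Ul Ur (Vacuum ul ur) \<longleftrightarrow>
     ((\<lambda>\<rho>. vel Ul + (rarefaction_integral E (dens Ul) (ent Ul) - rarefaction_integral E \<rho> (ent Ul)))
        \<longlongrightarrow> ul) (at_right 0) \<and>
     ((\<lambda>\<rho>. vel Ur - (rarefaction_integral E (dens Ur) (ent Ur) - rarefaction_integral E \<rho> (ent Ur)))
        \<longlongrightarrow> ur) (at_right 0) \<and>
     vel Ul \<le> ul \<and> ul \<le> ur \<and> ur \<le> vel Ur"

end

theory Submission
  imports Defs
begin

text \<open>
  Write \<open>E = f(S) K(\<tau>)\<close> and \<open>q = - K'\<close>, so that \<open>p = f(S) q(\<tau>)\<close>. With ahead state \<open>(\<tau>0, S0)\<close>, the Hugoniot
  relation becomes \<open>p (K / q - (\<tau>0 - \<tau>) / 2) = f(S0) (K(\<tau>0) + q(\<tau>0) (\<tau>0 - \<tau>) / 2)\<close>, which determines \<open>p\<close> from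
  \<open>\<tau>\<close>. The bracket on the left is increasing in \<open>\<tau>\<close> iff \<open>q\<^sup>2 < 2 K (- q')\<close>, which follows
  from convexity of \<open>k\<close>, by comparing \<open>k\<close> with its tangent line; it vanishes at some limiting
  volume below \<open>\<tau>0\<close> because \<open>K / q\<close> tends to \<open>0\<close> at \<open>0\<close>. Continued by the
  rarefaction branch, each wave curve is thus parametrized by volume, with pressure decreasing from
  \<open>\<infinity>\<close> to \<open>0\<close> and velocity drop decreasing from \<open>\<infinity>\<close> to \<open>- \<infinity>\<close>. The last limit expresses
  that \<open>k\<close> is not integrable at infinity, and it excludes the vacuum. Two such curves cross
  exactly once.
\<close>

section \<open>Crossing of wave curves\<close>

text \<open>The parameter is the specific volume behind the wave, \<open>P\<close> the pressure
  there, and \<open>W\<close> the drop in velocity from left to right across the wave, so one notion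
  serves both wave families. The bound \<open>a\<close> is the limiting volume of strong
  compression.\<close>

definition wave_curve :: "real \<Rightarrow> (real \<Rightarrow> real) \<Rightarrow> (real \<Rightarrow> real) \<Rightarrow> bool" where
  "wave_curve a P W \<longleftrightarrow>
     continuous_on {a<..} P \<and> continuous_on {a<..} W \<and>
     (\<forall>x y. a < x \<and> x < y \<longrightarrow> P y < P x \<and> W y < W x) \<and> (\<forall>x>a. 0 < P x) \<and>
     filterlim P at_top (at_right a) \<and> (P \<longlongrightarrow> 0) at_top \<and>
     filterlim W at_top (at_right a) \<and> filterlim W at_bot at_top"

lemma wave_curveD:
  assumes "wave_curve a P W"
  shows "continuous_on {a<..} P" "continuous_on {a<..} W"
    "\<And>x y. a < x \<Longrightarrow> x < y \<Longrightarrow> P y < P x" "\<And>x y. a < x \<Longrightarrow> x < y \<Longrightarrow> W y < W x"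
    "\<And>x. a < x \<Longrightarrow> 0 < P x" "filterlim P at_top (at_right a)" "(P \<longlongrightarrow> 0) at_top"
    "filterlim W at_top (at_right a)" "filterlim W at_bot at_top"
  using assms unfolding wave_curve_def by simp_all

lemma ivt_greaterThan:
  fixes g :: "real \<Rightarrow> real"
  assumes "continuous_on {a<..} g" "x1 > a" "g x1 \<le> y" "x2 > a" "y \<le> g x2"
  obtains x where "x > a" "g x = y"
proof -
  have "connected (g ` {a<..})"
    by (rule connected_continuous_image) (use assms in auto)
  then have "y \<in> g ` {a<..}"
    by (rule connectedD_interval[of _ "g x1" "g x2"]) (use assms in auto)
  then show ?thesis using that by auto
qed

lemma at_right_at_top_witness:
  fixes g :: "real \<Rightarrow> real"
  assumes "filterlim g at_top (at_right a)" "c > a"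
  obtains x where "a < x" "x < c" "y \<le> g x"
proof -
  have "eventually (\<lambda>x. y \<le> g x \<and> a < x \<and> x < c) (at_right a)"
    using assms(1) eventually_at_right_less[of a] eventually_at_right_real[OF assms(2)]
    unfolding filterlim_at_top by (auto elim: eventually_elim2)
  then obtain x where "y \<le> g x \<and> a < x \<and> x < c"
    using eventually_happens'[OF trivial_limit_at_right_real] by blast
  then show ?thesis using that by blast
qed

lemma at_top_witness:
  fixes c :: real
  assumes "eventually Q at_top"
  obtains x where "c < x" "Q x"
proof -
  have "eventually (\<lambda>x. c < x \<and> Q x) at_top"
    using assms eventually_gt_at_top[of c] by (simp add: eventually_conj_iff)
  then show ?thesis using that eventually_happens'[OF trivial_limit_at_top_linorder] by blast
qed

lemma wave_curve_pressure_onto: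
  assumes "wave_curve a P W" "y > 0"
  obtains x where "x > a" "P x = y"
proof -
  obtain x1 where "x1 > a" "P x1 < y"
    using at_top_witness[OF order_tendstoD(2)[OF wave_curveD(7)[OF assms(1)] assms(2)]] by blast
  moreover obtain x2 where "x2 > a" "y \<le> P x2"
    using at_right_at_top_witness[OF wave_curveD(6)[OF assms(1)], of "a + 1" y] by auto
  ultimately show ?thesis
    using ivt_greaterThan[OF wave_curveD(1)[OF assms(1)], of x1 y x2] that by auto
qed

text \<open>Equal pressures pair each \<open>x\<close> with one \<open>y\<close>, increasing in
  \<open>x\<close>. Along this pairing the sum of the two drops is continuous and strictly
  decreasing and passes \<open>u\<close>. For Riemann data, \<open>u\<close> is the left velocity
  minus the right one.\<close>

lemma wave_curves_cross:
  assumes 1: "wave_curve a P V" and 2: "wave_curve b Q W"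
  shows "\<exists>!(x, y). x > a \<and> y > b \<and> P x = Q y \<and> V x + W y = u"
proof -
  have mono: "\<And>x y. a < x \<Longrightarrow> x < y \<Longrightarrow> P y < P x \<and> V y < V x"
    "\<And>x y. b < x \<Longrightarrow> x < y \<Longrightarrow> Q y < Q x \<and> W y < W x"
    and P_pos: "\<And>x. x > a \<Longrightarrow> P x > 0" and Q_pos: "\<And>x. x > b \<Longrightarrow> Q x > 0"
    and cont: "continuous_on {a<..} V" "continuous_on {b<..} W"
    and lim: "filterlim V at_top (at_right a)" "filterlim V at_bot at_top"
    using wave_curveD[OF 1] wave_curveD[OF 2] by simp_all
  \<comment> \<open>Here \<open>t\<close> is the inverse of \<open>Q\<close> applied after
    \<open>P\<close>: the volume on the second curve with the same pressure.\<close>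
  have "\<exists>t. \<forall>x>a. t x > b \<and> Q (t x) = P x"
    by (intro choice allI) (use wave_curve_pressure_onto[OF 2 P_pos] in blast)
  then obtain t where t: "\<And>x. x > a \<Longrightarrow> t x > b" "\<And>x. x > a \<Longrightarrow> Q (t x) = P x" by blast
  have Q_less: "x < y" if "Q y < Q x" "x > b" "y > b" for x y
    using that mono(2) by (metis linorder_neqE order_less_asym less_irrefl)
  have t_less: "t x < t y" if "a < x" "x < y" for x y
    using that mono(1)[OF that] t[of x] t[of y] by (intro Q_less[of "t y" "t x"]) auto
  \<comment> \<open>A monotone map onto an open half-line has no jumps, which yields continuity of
    \<open>t\<close>.\<close>
  have "t ` {a<..} = {b<..}"
  proof (intro equalityI subsetI)
    fix y assume y: "y \<in> {b<..}"
    then obtain x where x: "x > a" "P x = Q y"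
      using wave_curve_pressure_onto[OF 1 Q_pos[of y]] by auto
    then have "t x = y"
      using t[of x] y mono(2) by (metis greaterThan_iff linorder_neqE less_irrefl)
    then show "y \<in> t ` {a<..}" using x by auto
  qed (use t in auto)
  moreover have "t x \<le> t y" if "x > a" "x \<le> y" for x y
    using t_less[of x y] that by (cases "x = y") auto
  ultimately have "continuous_on {a<..} t"
    by (intro continuous_onI_mono) auto
  then have cont_sum: "continuous_on {a<..} (\<lambda>x. V x + W (t x))"
    by (intro continuous_on_add cont continuous_on_compose2[OF cont(2)]) (use t in auto)
  \<comment> \<open>Any base point would do. Since \<open>W (t x)\<close> decreases in
    \<open>x\<close>, it lies above \<open>W (t c)\<close> left of \<open>c\<close> and below it
    right of \<open>c\<close>, so at both ends it suffices to compare \<open>V\<close> with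
    \<open>u - W (t c)\<close>.\<close>
  define c where "c = a + 1"
  have c: "c > a" by (simp add: c_def)
  obtain x2 where x2: "a < x2" "x2 < c" "u - W (t c) \<le> V x2"
    using at_right_at_top_witness[OF lim(1) c] by blast
  then have u2: "u \<le> V x2 + W (t x2)"
    using mono(2)[of "t x2" "t c"] t[of x2] t_less[of x2 c] by auto
  have "eventually (\<lambda>x. V x \<le> u - W (t c)) at_top"
    using lim(2) unfolding filterlim_at_bot by blast
  then obtain x1 where x1: "c < x1" "V x1 \<le> u - W (t c)"
    using at_top_witness by blast
  then have u1: "V x1 + W (t x1) \<le> u"
    using mono(2)[of "t c" "t x1"] t[of c] c t_less[of c x1] by auto
  obtain x where x: "x > a" "V x + W (t x) = u"
    using ivt_greaterThan[OF cont_sum _ u1 _ u2] x1 x2 c by auto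
  have uniq: "x = x' \<and> y = y'"
    if "x > a" "y > b" "P x = Q y" "V x + W y = u" "x' > a" "y' > b" "P x' = Q y'" "V x' + W y' = u"
    for x y x' y'
  proof -
    \<comment> \<open>If \<open>x < x'\<close>, the lower pressure at \<open>x'\<close> forces
      \<open>y < y'\<close>; then both drops are smaller, against the equality of the sums.\<close>
    have False if *: "x > a" "y > b" "P x = Q y" "V x + W y = u"
      "y' > b" "P x' = Q y'" "V x' + W y' = u" "x < x'" for x y x' y'
    proof -
      have "P x' < P x" "V x' < V x" using mono(1)[of x x'] * by auto
      then have "y < y'" using * Q_less[of y' y] by auto
      then have "W y' < W y" using mono(2)[of y y'] * by auto
      then show False using \<open>V x' < V x\<close> * by linarith
    qed
    from this[of x y y' x'] this[of x' y' y x] have "x = x'"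
      using that by (metis linorder_neqE)
    moreover have "y = y'"
      using mono(2)[of y y'] mono(2)[of y' y] that \<open>x = x'\<close> by (metis less_irrefl linorder_neqE)
    ultimately show ?thesis by simp
  qed
  show ?thesis
  proof (rule ex1I[of _ "(x, t x)"])
    show "case (x, t x) of (x, y) \<Rightarrow> x > a \<and> y > b \<and> P x = Q y \<and> V x + W y = u"
      using x t[of x] by simp
  qed (use x t[of x] uniq in \<open>auto split: prod.splits\<close>)
qed

section \<open>Gases with separable internal energy\<close>

text \<open>The interface between the gas at hand and the wave analysis. Injectivity and
  surjectivity of \<open>f\<close> make entropy and pressure interchangeable at fixed volume.
  \<open>G\<close> measures the velocity change along an isentrope, up to the factor
  \<open>sqrt (f S)\<close>; its divergence is what rules out the vacuum.\<close>

locale separable_gas =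
  fixes E :: "real \<Rightarrow> real \<Rightarrow> real" and f K q q' G :: "real \<Rightarrow> real"
  assumes E_eq: "\<tau> > 0 \<Longrightarrow> E \<tau> S = f S * K \<tau>"
    and f_pos: "f S > 0"
    and f_inj: "inj f"
    and f_onto: "y > 0 \<Longrightarrow> \<exists>S. f S = y"
    and K_pos: "\<tau> > 0 \<Longrightarrow> K \<tau> > 0"
    and K_deriv: "\<tau> > 0 \<Longrightarrow> (K has_real_derivative - q \<tau>) (at \<tau>)"
    and q_pos: "\<tau> > 0 \<Longrightarrow> q \<tau> > 0"
    and q_deriv: "\<tau> > 0 \<Longrightarrow> (q has_real_derivative q' \<tau>) (at \<tau>)"
    and q'_neg: "\<tau> > 0 \<Longrightarrow> q' \<tau> < 0"
    and q'_cont: "continuous_on {0<..} q'"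
    and shock_monotone: "\<tau> > 0 \<Longrightarrow> (q \<tau>)\<^sup>2 < 2 * K \<tau> * (- q' \<tau>)"
    and q_at_top: "(q \<longlongrightarrow> 0) at_top"
    and K_q_at_0: "((\<lambda>\<tau>. K \<tau> / q \<tau>) \<longlongrightarrow> 0) (at_right 0)"
    and G_deriv: "\<tau> > 0 \<Longrightarrow> (G has_real_derivative sqrt (- q' \<tau>)) (at \<tau>)"
    and G_at_top: "filterlim G at_top at_top"
begin

lemma K_cont: "continuous_on {0<..} K"
  using K_deriv by (intro continuous_at_imp_continuous_on) (auto intro: DERIV_isCont)

lemma q_cont: "continuous_on {0<..} q"
  using q_deriv by (intro continuous_at_imp_continuous_on) (auto intro: DERIV_isCont)

lemma G_cont: "continuous_on {0<..} G"
  using G_deriv by (intro continuous_at_imp_continuous_on) (auto intro: DERIV_isCont)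

lemma q_less: "0 < s \<Longrightarrow> s < t \<Longrightarrow> q t < q s"
  by (rule DERIV_neg_imp_decreasing[of s t q]) (auto intro!: exI q_deriv q'_neg)

lemma G_less: "0 < s \<Longrightarrow> s < t \<Longrightarrow> G s < G t"
proof (rule DERIV_pos_imp_increasing[of s t G])
  fix x assume "0 < s" "s \<le> x"
  then show "\<exists>y. (G has_real_derivative y) (at x) \<and> 0 < y"
    using G_deriv[of x] q'_neg[of x] by (intro exI[of _ "sqrt (- q' x)"]) auto
qed auto

section \<open>Pressure, sound speed and rarefactions in terms of specific volume\<close>

lemma pressure_eq:
  assumes "\<tau> > 0"
  shows "pressure E \<tau> S = f S * q \<tau>"
proof -
  have "((\<lambda>t. f S * K t) has_real_derivative f S * - q \<tau>) (at \<tau>)"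
    using K_deriv[OF assms] by (rule DERIV_cmult)
  then have "((\<lambda>t. E t S) has_real_derivative f S * - q \<tau>) (at \<tau>)"
    by (rule has_field_derivative_transform_within_open[of _ _ _ "{0<..}"])
       (use E_eq assms in auto)
  then show ?thesis by (simp add: pressure_def partial1_def DERIV_imp_deriv)
qed

lemma sound_speed_eq:
  assumes "\<rho> > 0"
  shows "sound_speed E \<rho> S = sqrt (f S) * sqrt (- q' (1 / \<rho>)) / \<rho>"
proof -
  have "((\<lambda>r. f S * q (1 / r)) has_real_derivative f S * (q' (1 / \<rho>) * (- 1 / \<rho>\<^sup>2))) (at \<rho>)"
    by (intro DERIV_cmult DERIV_chain2[OF q_deriv])
       (use assms in \<open>auto intro!: derivative_eq_intros simp: power2_eq_square\<close>)
  then have "((\<lambda>r. pressure_hat E r S) has_real_derivative f S * (q' (1 / \<rho>) * (- 1 / \<rho>\<^sup>2)))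
      (at \<rho>)"
    by (rule has_field_derivative_transform_within_open[of _ _ _ "{0<..}"])
       (use assms in \<open>auto simp: pressure_hat_def pressure_eq\<close>)
  then have "partial1 (pressure_hat E) \<rho> S = f S * - q' (1 / \<rho>) / \<rho>\<^sup>2"
    unfolding partial1_def by (simp add: DERIV_imp_deriv)
  then show ?thesis
    using assms unfolding sound_speed_def by (simp only: real_sqrt_divide real_sqrt_mult) simp
qed

text \<open>The substitution \<open>\<tau> = 1 / r\<close> turns the integrand into the square root
  of minus the volume derivative of the pressure, whose antiderivative is
  \<open>sqrt (f S) * G\<close>; reversing the orientation accounts for the sign.\<close>

lemma rarefaction_integral_eq:
  assumes "\<rho> > 0"
  shows "rarefaction_integral E \<rho> S = sqrt (f S) * (G 1 - G (1 / \<rho>))"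
proof -
  define g where "g = (\<lambda>r. sqrt (f S) * sqrt (- q' (1 / r)) / r\<^sup>2)"
  \<comment> \<open>The density may lie on either side of 1, and the integral is oriented.\<close>
  let ?I = "{min 1 \<rho>..max 1 \<rho>}"
  have pos: "x > 0" if "x \<in> ?I" for x using that assms by auto
  have "continuous_on ?I (\<lambda>r. q' (1 / r))"
    by (rule continuous_on_compose2[OF q'_cont]) (use pos in \<open>force intro!: continuous_intros\<close>)+
  then have "continuous_on ?I g"
    unfolding g_def by (intro continuous_intros) (use pos in force)+
  moreover have deriv: "((\<lambda>r. - sqrt (f S) * G (1 / r)) has_real_derivative g x) (at x)" if "x > 0" for x
    unfolding g_def
    by (rule DERIV_cong[OF DERIV_cmult[OF DERIV_chain2[OF G_deriv, where Db = "- 1 / x\<^sup>2"]]])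
       (use that in \<open>auto intro!: derivative_eq_intros simp: power2_eq_square\<close>)
  ultimately have "(LBINT r=ereal 1..ereal \<rho>. g r) = - sqrt (f S) * G (1 / \<rho>) - - sqrt (f S) * G (1 / 1)"
    by (intro interval_integral_FTC_finite)
       (use pos in \<open>auto simp flip: has_real_derivative_iff_has_vector_derivative
          intro: has_field_derivative_at_within\<close>)
  moreover have "rarefaction_integral E \<rho> S = (LBINT r=ereal 1..ereal \<rho>. g r)"
    unfolding rarefaction_integral_def g_def
  proof (rule interval_integral_cong)
    fix x assume "x \<in> einterval (min (ereal 1) (ereal \<rho>)) (max (ereal 1) (ereal \<rho>))"
    then have "x > 0" using assms by (auto simp: einterval_def min_def split: if_splits)
    then show "sound_speed E x S / x = sqrt (f S) * sqrt (- q' (1 / x)) / x\<^sup>2"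
      by (simp add: sound_speed_eq power2_eq_square)
  qed
  ultimately show ?thesis by (simp add: algebra_simps)
qed

lemma rarefaction_integral_at_bot:
  "filterlim (\<lambda>\<rho>. rarefaction_integral E \<rho> S) at_bot (at_right 0)"
proof -
  have "filterlim (\<lambda>\<rho>. G (1 / \<rho>)) at_top (at_right 0)"
    using filterlim_compose[OF G_at_top filterlim_inverse_at_top_right] by (simp add: inverse_eq_divide)
  then have "filterlim (\<lambda>\<rho>. - G 1 + G (1 / \<rho>)) at_top (at_right 0)"
    by (rule filterlim_tendsto_add_at_top[OF tendsto_const])
  then have "filterlim (\<lambda>\<rho>. sqrt (f S) * (- G 1 + G (1 / \<rho>))) at_top (at_right 0)"
    by (intro filterlim_tendsto_pos_mult_at_top[OF tendsto_const]) (simp_all add: f_pos)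
  then have "filterlim (\<lambda>\<rho>. sqrt (f S) * (G 1 - G (1 / \<rho>))) at_bot (at_right 0)"
    by (simp add: filterlim_uminus_at_bot algebra_simps)
  then show ?thesis
    by (rule filterlim_mono_eventually) (auto simp: rarefaction_integral_eq eventually_at_filter)
qed

text \<open>Along the backward rarefaction the velocity grows without bound as the density tends to
  0, so the left edge of a vacuum would have no finite velocity.\<close>

lemma not_riemann_solution_Vacuum: "\<not> riemann_solution E Ul Ur (Vacuum ul ur)"
proof
  assume "riemann_solution E Ul Ur (Vacuum ul ur)"
  then have "((\<lambda>\<rho>. vel Ul + (rarefaction_integral E (dens Ul) (ent Ul) -
      rarefaction_integral E \<rho> (ent Ul))) \<longlongrightarrow> ul) (at_right 0)"
    by simp
  moreover have "filterlim (\<lambda>\<rho>. vel Ul + (rarefaction_integral E (dens Ul) (ent Ul) +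
      - rarefaction_integral E \<rho> (ent Ul))) at_top (at_right 0)"
    using rarefaction_integral_at_bot unfolding filterlim_uminus_at_bot
    by (intro filterlim_tendsto_add_at_top[OF tendsto_const])
  ultimately show False
    using not_tendsto_and_filterlim_at_infinity[OF trivial_limit_at_right_real]
      filterlim_at_top_imp_at_infinity by fastforce
qed

section \<open>The shock branch and the complete wave curves\<close>

definition shock_factor :: "real \<Rightarrow> real \<Rightarrow> real" where
  "shock_factor \<tau>0 \<tau> = K \<tau> / q \<tau> - (\<tau>0 - \<tau>) / 2"

lemma shock_factor_cont: "continuous_on {0<..} (shock_factor \<tau>0)"
  unfolding shock_factor_def[abs_def]
  by (intro continuous_intros K_cont q_cont) (use q_pos in force)+

text \<open>The derivative simplifies to \<open>K * (- q') / q\<^sup>2 - 1 / 2\<close>, and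
  \<open>shock_monotone\<close> says exactly that this is positive.\<close>

lemma shock_factor_less:
  assumes "0 < s" "s < t"
  shows "shock_factor \<tau>0 s < shock_factor \<tau>0 t"
proof (rule DERIV_pos_imp_increasing[OF assms(2)])
  fix x assume "s \<le> x"
  then have x: "x > 0" using assms by simp
  have "(shock_factor \<tau>0 has_real_derivative
      (- q x * q x - K x * q' x) / (q x * q x) - (0 - 1) / 2) (at x)"
    unfolding shock_factor_def[abs_def]
    by (intro DERIV_diff DERIV_divide DERIV_cdivide DERIV_const DERIV_ident K_deriv q_deriv)
       (use x q_pos in force)+
  moreover have "(- q x * q x - K x * q' x) / (q x * q x) - (0 - 1) / 2 > 0"
    using shock_monotone[OF x] q_pos[OF x] by (simp add: field_simps power2_eq_square)
  ultimately show "\<exists>y. (shock_factor \<tau>0 has_real_derivative y) (at x) \<and> y > 0" by blast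
qed

text \<open>The factor tends to \<open>- \<tau>0 / 2\<close> at 0 and equals
  \<open>K \<tau>0 / q \<tau>0 > 0\<close> at \<open>\<tau>0\<close>. Its zero is the volume that
  shocks into the state ahead approach as their strength grows.\<close>

lemma shock_factor_zero:
  assumes "\<tau>0 > 0"
  obtains a where "0 < a" "a < \<tau>0" "shock_factor \<tau>0 a = 0"
proof -
  have "((\<lambda>\<tau>. K \<tau> / q \<tau> - (\<tau>0 - \<tau>) / 2) \<longlongrightarrow> 0 - (\<tau>0 - 0) / 2) (at_right 0)"
    by (intro tendsto_intros K_q_at_0) auto
  then have "eventually (\<lambda>\<tau>. shock_factor \<tau>0 \<tau> < 0) (at_right 0)"
    unfolding shock_factor_def by (rule order_tendstoD) (use assms in simp)
  then have "eventually (\<lambda>\<tau>. shock_factor \<tau>0 \<tau> < 0 \<and> \<tau> \<in> {0<..<\<tau>0}) (at_right 0)"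
    using eventually_at_right_real[OF assms] by (rule eventually_conj)
  then obtain s where s: "shock_factor \<tau>0 s < 0" "0 < s" "s < \<tau>0"
    using eventually_happens'[OF trivial_limit_at_right_real] by (metis (no_types, lifting) greaterThanLessThan_iff)
  have top: "shock_factor \<tau>0 \<tau>0 > 0"
    using K_pos q_pos assms by (simp add: shock_factor_def)
  have "continuous_on {s..\<tau>0} (shock_factor \<tau>0)"
    by (rule continuous_on_subset[OF shock_factor_cont]) (use s in auto)
  then obtain a where "s \<le> a" "a \<le> \<tau>0" "shock_factor \<tau>0 a = 0"
    using IVT'[of "shock_factor \<tau>0" s 0 \<tau>0] s top by auto
  then show ?thesis using that[of a] s top by (cases "a = \<tau>0") auto
qed

text \<open>Compression follows the Hugoniot relation solved for the pressure behind, expansion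
  follows the isentrope. On the first branch only volumes above the zero of
  \<open>shock_factor\<close> have a physical meaning.\<close>

definition curve_pressure :: "gas_state \<Rightarrow> real \<Rightarrow> real" where
  "curve_pressure A \<tau> = (let \<tau>0 = volume_at A; f0 = f (ent A) in
     if \<tau> \<le> \<tau>0 then f0 * (K \<tau>0 + q \<tau>0 * (\<tau>0 - \<tau>) / 2) / shock_factor \<tau>0 \<tau> else f0 * q \<tau>)"

text \<open>The drop is signed: nonnegative for compression, where it is the root in the jump
  condition, and negative for expansion.\<close>

definition curve_velocity :: "gas_state \<Rightarrow> real \<Rightarrow> real" where
  "curve_velocity A \<tau> = (let \<tau>0 = volume_at A; f0 = f (ent A) in
     if \<tau> \<le> \<tau>0 then sqrt ((curve_pressure A \<tau> - f0 * q \<tau>0) * (\<tau>0 - \<tau>))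
     else sqrt f0 * (G \<tau>0 - G \<tau>))"

text \<open>On the shock branch a decreasing positive numerator is divided by an increasing
  denominator that vanishes at \<open>a\<close>; on the rarefaction branch the pressure follows
  \<open>q\<close> and the drop follows \<open>- G\<close>. The two branches agree at the volume
  ahead.\<close>

lemma wave_curve_of_state:
  assumes "dens A > 0" "0 < a" "a < volume_at A" "shock_factor (volume_at A) a = 0"
  shows "wave_curve a (curve_pressure A) (curve_velocity A)"
proof -
  define \<tau>0 where "\<tau>0 = volume_at A"
  define f0 where "f0 = f (ent A)"
  define N where "N = (\<lambda>\<tau>. f0 * (K \<tau>0 + q \<tau>0 * (\<tau>0 - \<tau>) / 2))"
  define H where "H = (\<lambda>\<tau>. N \<tau> / shock_factor \<tau>0 \<tau>)"
  let ?P = "curve_pressure A" and ?W = "curve_velocity A"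
  have a: "0 < a" "a < \<tau>0" "shock_factor \<tau>0 a = 0" and \<tau>0: "\<tau>0 > 0"
    using assms by (auto simp: \<tau>0_def)
  have f0: "f0 > 0" by (simp add: f0_def f_pos)
  have q0: "q \<tau>0 > 0" and K0: "K \<tau>0 > 0" using q_pos K_pos \<tau>0 by auto
  have P_shock: "?P \<tau> = H \<tau>" if "\<tau> \<le> \<tau>0" for \<tau>
    using that by (simp add: curve_pressure_def H_def N_def \<tau>0_def f0_def Let_def)
  \<comment> \<open>Agreement at \<open>\<tau>0\<close> lets each formula hold up to and including
    that point, so both pieces are closed in \<open>{a<..}\<close> and can be glued.\<close>
  have H0: "H \<tau>0 = f0 * q \<tau>0"
    using K0 q0 by (simp add: H_def N_def shock_factor_def)
  have P_rare: "?P \<tau> = f0 * q \<tau>" if "\<tau> \<ge> \<tau>0" for \<tau>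
    using that H0 P_shock[of \<tau>0] by (cases "\<tau> = \<tau>0")
      (simp_all add: curve_pressure_def Let_def flip: \<tau>0_def f0_def)
  have W_shock: "?W \<tau> = sqrt ((H \<tau> - f0 * q \<tau>0) * (\<tau>0 - \<tau>))" if "\<tau> \<le> \<tau>0" for \<tau>
    using that P_shock[OF that] by (simp add: curve_velocity_def \<tau>0_def f0_def Let_def)
  have W_rare: "?W \<tau> = sqrt f0 * (G \<tau>0 - G \<tau>)" if "\<tau> \<ge> \<tau>0" for \<tau>
    using that W_shock[of \<tau>0] by (cases "\<tau> = \<tau>0")
      (simp_all add: curve_velocity_def Let_def flip: \<tau>0_def f0_def)
  have m_pos: "shock_factor \<tau>0 \<tau> > 0" if "\<tau> > a" for \<tau>
    using shock_factor_less[of a \<tau> \<tau>0] a that by simp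
  have N_pos: "N \<tau> > 0" if "\<tau> \<le> \<tau>0" for \<tau>
    unfolding N_def using f0 q0 K0 that by (intro mult_pos_pos add_pos_nonneg) auto
  have H_less: "H t < H s" if "a < s" "s < t" "t \<le> \<tau>0" for s t
    unfolding H_def
  proof (rule frac_less2)
    show "N t \<le> N s" using that f0 q0 by (simp add: N_def)
    show "shock_factor \<tau>0 s < shock_factor \<tau>0 t" using shock_factor_less that a by simp
  qed (use that m_pos N_pos in auto)
  have PW_shock: "?P t < ?P s \<and> ?W t < ?W s" if "a < s" "s < t" "t \<le> \<tau>0" for s t
  proof -
    \<comment> \<open>The pressure jump must be nonnegative before the two decreasing factors under
      the root may be multiplied.\<close>
    have "f0 * q \<tau>0 \<le> H t" using H_less[of t \<tau>0] H0 that by (cases "t = \<tau>0") auto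
    then have "(H t - f0 * q \<tau>0) * (\<tau>0 - t) < (H s - f0 * q \<tau>0) * (\<tau>0 - s)"
      using H_less[OF that] that by (intro mult_strict_mono') auto
    then show ?thesis using H_less[OF that] that by (simp add: P_shock W_shock)
  qed
  have PW_rare: "?P t < ?P s \<and> ?W t < ?W s" if "\<tau>0 \<le> s" "s < t" for s t
    using that \<tau>0 f0 q_less[of s t] G_less[of s t] by (simp add: P_rare W_rare)
  have less: "?P t < ?P s \<and> ?W t < ?W s" if "a < s" "s < t" for s t
    using PW_shock[of s t] PW_shock[of s \<tau>0] PW_rare[of s t] PW_rare[of \<tau>0 t] that
    by (cases "t \<le> \<tau>0"; cases "\<tau>0 \<le> s") auto
  have union: "{a<..} = {a<..\<tau>0} \<union> {\<tau>0..}" using a by auto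
  have N_cont: "continuous_on S N" for S
    unfolding N_def by (intro continuous_intros) auto
  have H_cont: "continuous_on {a<..\<tau>0} H"
    unfolding H_def
    by (intro continuous_intros N_cont continuous_on_subset[OF shock_factor_cont])
       (use m_pos a in force)+
  have glue: "continuous_on {a<..} g" if "continuous_on {a<..\<tau>0} g" "continuous_on {\<tau>0..} g"
    for g :: "real \<Rightarrow> real"
    unfolding continuous_on_eq_continuous_within
  proof
    fix x assume "x \<in> {a<..}"
    have "closedin (top_of_set {a<..}) {a<..\<tau>0}"
      unfolding closedin_closed by (rule exI[of _ "{..\<tau>0}"]) auto
    moreover have "closedin (top_of_set {a<..}) {\<tau>0..}"
      unfolding closedin_closed by (rule exI[of _ "{\<tau>0..}"]) (use a in auto)
    ultimately have "continuous_on ({a<..\<tau>0} \<union> {\<tau>0..}) g"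
      using that union by (intro continuous_on_Un_local) auto
    then show "continuous (at x within {a<..}) g"
      using \<open>x \<in> {a<..}\<close> by (simp add: union continuous_on_eq_continuous_within)
  qed
  have "continuous_on {a<..\<tau>0} ?P"
    using H_cont by (rule continuous_on_eq) (simp add: P_shock)
  moreover have "continuous_on {\<tau>0..} ?P"
    by (rule continuous_on_eq[of _ "\<lambda>\<tau>. f0 * q \<tau>"])
       (auto simp: P_rare intro!: continuous_intros continuous_on_subset[OF q_cont] less_le_trans[OF \<tau>0])
  ultimately have P_cont: "continuous_on {a<..} ?P" by (rule glue)
  have "continuous_on {a<..\<tau>0} ?W"
    by (rule continuous_on_eq[of _ "\<lambda>\<tau>. sqrt ((H \<tau> - f0 * q \<tau>0) * (\<tau>0 - \<tau>))"])
       (auto simp: W_shock intro!: continuous_intros H_cont)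
  moreover have "continuous_on {\<tau>0..} ?W"
    by (rule continuous_on_eq[of _ "\<lambda>\<tau>. sqrt f0 * (G \<tau>0 - G \<tau>)"])
       (auto simp: W_rare intro!: continuous_intros continuous_on_subset[OF G_cont] less_le_trans[OF \<tau>0])
  ultimately have W_cont: "continuous_on {a<..} ?W" by (rule glue)
  have P_pos: "?P \<tau> > 0" if "\<tau> > a" for \<tau>
    using that m_pos N_pos f0 q_pos[of \<tau>] \<tau>0 
    by (cases "\<tau> \<le> \<tau>0") (simp_all add: P_shock P_rare H_def)
  \<comment> \<open>Continuity gives the limit 0; positivity to the right of \<open>a\<close> makes
    the approach one-sided, so the reciprocal tends to plus infinity.\<close>
  have "(shock_factor \<tau>0 \<longlongrightarrow> shock_factor \<tau>0 a) (at a)"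
    using shock_factor_cont[of \<tau>0] a(1) by (simp add: continuous_on_eq_continuous_at isCont_def)
  then have "(shock_factor \<tau>0 \<longlongrightarrow> 0) (at_right a)"
    using a(3) by (simp add: filterlim_at_split)
  then have "filterlim (shock_factor \<tau>0) (at_right 0) (at_right a)"
    unfolding filterlim_at using m_pos
    by (auto intro!: eventually_mono[OF eventually_at_right_less] simp: less_imp_neq[symmetric])
  then have m_lim: "filterlim (\<lambda>\<tau>. inverse (shock_factor \<tau>0 \<tau>)) at_top (at_right a)"
    by (rule filterlim_compose[OF filterlim_inverse_at_top_right])
  have "(N \<longlongrightarrow> N a) (at_right a)"
    using N_cont[of UNIV] by (simp add: continuous_on_def filterlim_at_split)
  then have H_lim: "filterlim H at_top (at_right a)"
    unfolding H_def divide_inverse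
    by (rule filterlim_tendsto_pos_mult_at_top[OF _ N_pos m_lim]) (use a in auto)
  have near: "eventually (\<lambda>\<tau>. \<tau> \<le> \<tau>0) (at_right a)"
    using eventually_at_right_real[OF a(2)] by (auto elim: eventually_mono)
  have P_lim: "filterlim ?P at_top (at_right a)"
    by (rule filterlim_mono_eventually[OF H_lim]) (use near P_shock in \<open>auto elim: eventually_mono\<close>)
  have "((\<lambda>\<tau>. \<tau>0 - \<tau>) \<longlongrightarrow> \<tau>0 - a) (at_right a)" by (intro tendsto_intros)
  moreover have "filterlim (\<lambda>\<tau>. H \<tau> - f0 * q \<tau>0) at_top (at_right a)"
    using filterlim_tendsto_add_at_top[OF tendsto_const H_lim, of "- (f0 * q \<tau>0)"] by simp
  ultimately have "filterlim (\<lambda>\<tau>. (\<tau>0 - \<tau>) * (H \<tau> - f0 * q \<tau>0)) at_top (at_right a)"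
    using a by (intro filterlim_tendsto_pos_mult_at_top[of "\<lambda>\<tau>. \<tau>0 - \<tau>" "\<tau>0 - a"]) auto
  then have "filterlim (\<lambda>\<tau>. sqrt ((\<tau>0 - \<tau>) * (H \<tau> - f0 * q \<tau>0))) at_top (at_right a)"
    by (rule filterlim_compose[OF sqrt_at_top])
  then have W_lim: "filterlim ?W at_top (at_right a)"
    by (rule filterlim_mono_eventually) (use near W_shock in \<open>auto elim!: eventually_mono simp: mult.commute\<close>)
  have far: "eventually (\<lambda>\<tau>. \<tau> \<ge> \<tau>0) at_top" by (rule eventually_ge_at_top)
  have "((\<lambda>\<tau>. f0 * q \<tau>) \<longlongrightarrow> f0 * 0) at_top" by (intro tendsto_intros q_at_top)
  then have "((\<lambda>\<tau>. f0 * q \<tau>) \<longlongrightarrow> 0) at_top" by simp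
  then have P_top: "(?P \<longlongrightarrow> 0) at_top"
    by (rule filterlim_mono_eventually) (use P_rare in \<open>auto intro!: eventually_mono[OF far]\<close>)
  have "filterlim (\<lambda>\<tau>. sqrt f0 * (- G \<tau>0 + G \<tau>)) at_top at_top"
    by (rule filterlim_tendsto_pos_mult_at_top[OF tendsto_const _
          filterlim_tendsto_add_at_top[OF tendsto_const G_at_top]]) (simp add: f0)
  then have "filterlim (\<lambda>\<tau>. sqrt f0 * (G \<tau>0 - G \<tau>)) at_bot at_top"
    by (simp add: filterlim_uminus_at_bot algebra_simps)
  then have W_top: "filterlim ?W at_bot at_top"
    by (rule filterlim_mono_eventually) (use W_rare in \<open>auto intro!: eventually_mono[OF far]\<close>)
  show ?thesis
    unfolding wave_curve_def using P_cont W_cont less P_pos P_lim W_lim P_top W_top by simp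
qed

text \<open>Replacing \<open>f (ent U)\<close> by \<open>p / q \<tau>\<close> eliminates the unknown
  entropy and leaves an equation linear in \<open>p\<close>, with coefficient
  \<open>shock_factor\<close>.\<close>

lemma hugoniot_iff:
  assumes "dens A > 0" "dens U > 0"
  defines "p \<equiv> pressure_at E U" and "\<tau>0 \<equiv> volume_at A" and "\<tau> \<equiv> volume_at U"
  shows "energy_at E U - energy_at E A + (pressure_at E A + p) / 2 * (\<tau> - \<tau>0) = 0 \<longleftrightarrow>
    p * shock_factor \<tau>0 \<tau> = f (ent A) * (K \<tau>0 + q \<tau>0 * (\<tau>0 - \<tau>) / 2)"
proof -
  have pos: "\<tau> > 0" "\<tau>0 > 0" using assms by (auto simp: volume_at_def)
  have "q \<tau> \<noteq> 0" using q_pos pos by force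
  then have "p * shock_factor \<tau>0 \<tau> = f (ent U) * K \<tau> - p * (\<tau>0 - \<tau>) / 2"
    using pos unfolding p_def shock_factor_def pressure_at_def
    by (simp add: pressure_eq flip: \<tau>_def) (simp add: field_simps)
  moreover have "energy_at E U = f (ent U) * K \<tau>" "energy_at E A = f (ent A) * K \<tau>0"
    "pressure_at E A = f (ent A) * q \<tau>0"
    using pos by (simp_all add: energy_at_def pressure_at_def E_eq pressure_eq flip: \<tau>_def \<tau>0_def)
  ultimately show ?thesis by (simp add: field_simps) argo
qed

text \<open>The volume separates the alternatives: below the volume ahead only a shock is possible,
  above it only a rarefaction, and at it only equality. The curve records pressure instead of
  entropy, which loses nothing because \<open>f\<close> is injective.\<close>

lemma wave_iff_curve:
  assumes "dens A > 0" "dens U > 0" "0 < a" "a < volume_at A" "shock_factor (volume_at A) a = 0"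
  shows backward_wave_iff: "backward_shock E A U \<or> backward_rarefaction E A U \<or> A = U \<longleftrightarrow>
      volume_at U > a \<and> pressure_at E U = curve_pressure A (volume_at U) \<and>
      vel U = vel A - curve_velocity A (volume_at U)" (is ?B)
    and forward_wave_iff: "forward_shock E U A \<or> forward_rarefaction E U A \<or> U = A \<longleftrightarrow>
      volume_at U > a \<and> pressure_at E U = curve_pressure A (volume_at U) \<and>
      vel U = vel A + curve_velocity A (volume_at U)" (is ?F)
proof -
  define \<tau>0 where "\<tau>0 = volume_at A"
  define \<tau> where "\<tau> = volume_at U"
  define f0 where "f0 = f (ent A)"
  define p where "p = pressure_at E U"
  have pos: "\<tau> > 0" "\<tau>0 > 0" using assms by (auto simp: volume_at_def \<tau>_def \<tau>0_def)
  have a: "a < \<tau>0" using assms by (simp add: \<tau>0_def)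
  note curve = wave_curveD[OF wave_curve_of_state[OF assms(1,3-5)]]
  have p: "p = f (ent U) * q \<tau>" using pos by (simp add: p_def pressure_at_def pressure_eq \<tau>_def)
  have pA: "pressure_at E A = f0 * q \<tau>0"
    using pos by (simp add: pressure_at_def pressure_eq Let_def \<tau>0_def f0_def)
  have "K \<tau>0 > 0" "q \<tau>0 > 0" using K_pos q_pos pos by auto
  then have P0: "curve_pressure A \<tau>0 = f0 * q \<tau>0"
    by (simp add: curve_pressure_def shock_factor_def Let_def \<tau>0_def f0_def)
  have "?B \<and> ?F"
  proof (cases "\<tau> < \<tau>0")
    case True
    then have dens: "dens U > dens A"
      using assms by (simp add: \<tau>_def \<tau>0_def volume_at_def field_simps)
    have W: "curve_velocity A \<tau> = sqrt ((curve_pressure A \<tau> - f0 * q \<tau>0) * (\<tau>0 - \<tau>))"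
      using True by (simp add: curve_velocity_def Let_def \<tau>0_def f0_def)
    have "p > 0" using p f_pos q_pos pos by simp
    have num: "f0 * (K \<tau>0 + q \<tau>0 * (\<tau>0 - \<tau>) / 2) > 0"
      using f_pos \<open>K \<tau>0 > 0\<close> \<open>q \<tau>0 > 0\<close> True unfolding f0_def
      by (intro mult_pos_pos add_pos_nonneg) auto
    have m: "shock_factor \<tau>0 \<tau> > 0 \<longleftrightarrow> \<tau> > a"
      using shock_factor_less[of a \<tau> \<tau>0] shock_factor_less[of \<tau> a \<tau>0] pos assms
      by (metis \<tau>0_def linorder_neqE less_irrefl order_less_asym)
    have P: "curve_pressure A \<tau> = f0 * (K \<tau>0 + q \<tau>0 * (\<tau>0 - \<tau>) / 2) / shock_factor \<tau>0 \<tau>"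
      using True by (simp add: curve_pressure_def Let_def \<tau>0_def f0_def)
    \<comment> \<open>The right side and \<open>p\<close> are positive, so the equation itself
      forces a positive factor, that is, \<open>\<tau> > a\<close>.\<close>
    have hug: "p * shock_factor \<tau>0 \<tau> = f0 * (K \<tau>0 + q \<tau>0 * (\<tau>0 - \<tau>) / 2) \<longleftrightarrow>
        \<tau> > a \<and> p = curve_pressure A \<tau>" (is "?l \<longleftrightarrow> ?r")
    proof
      assume ?l
      then have "p * shock_factor \<tau>0 \<tau> > 0" using num by simp
      then have "shock_factor \<tau>0 \<tau> > 0" using \<open>p > 0\<close> by (simp add: zero_less_mult_iff)
      then show ?r using \<open>?l\<close> m by (simp add: P eq_divide_eq)
    next
      assume ?r
      then have "shock_factor \<tau>0 \<tau> > 0" using m by simp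
      then show ?l using \<open>?r\<close> by (simp add: P)
    qed
    note hug = hug[folded hugoniot_iff[OF assms(1,2), folded p_def \<tau>_def \<tau>0_def f0_def]]
    \<comment> \<open>The curve decreases to the pressure ahead at \<open>\<tau>0\<close>, so the
      pressure inequality demanded of a shock holds automatically.\<close>
    have gt: "curve_pressure A \<tau> > f0 * q \<tau>0" if "\<tau> > a"
      using curve(3)[OF that True] P0 by simp
    \<comment> \<open>Exchanging the states negates the energy relation and keeps the product of the
      jumps, so \<open>hug\<close> serves both families.\<close>
    have sym: "energy_at E A - energy_at E U + (p + pressure_at E A) / 2 * (\<tau>0 - \<tau>) =
        - (energy_at E U - energy_at E A + (pressure_at E A + p) / 2 * (\<tau> - \<tau>0))"
      by (simp add: field_simps)
    have drop: "- ((p - pressure_at E A) * (\<tau> - \<tau>0)) = (p - f0 * q \<tau>0) * (\<tau>0 - \<tau>)"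
      "- ((pressure_at E A - p) * (\<tau>0 - \<tau>)) = (p - f0 * q \<tau>0) * (\<tau>0 - \<tau>)"
      by (simp_all add: pA algebra_simps)
    have "rankine_hugoniot E A U \<longleftrightarrow> \<tau> > a \<and> p = curve_pressure A \<tau> \<and>
        vel U - vel A = - sqrt ((p - f0 * q \<tau>0) * (\<tau>0 - \<tau>))"
      unfolding rankine_hugoniot_def jump_def average_def p_def[symmetric] \<tau>_def[symmetric]
        \<tau>0_def[symmetric] drop hug by simp
    then have "backward_shock E A U \<longleftrightarrow> \<tau> > a \<and> p = curve_pressure A \<tau> \<and> vel U = vel A - curve_velocity A \<tau>"
      using gt dens pA W unfolding backward_shock_def p_def[symmetric] by auto
    moreover have "rankine_hugoniot E U A \<longleftrightarrow> \<tau> > a \<and> p = curve_pressure A \<tau> \<and>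
        vel A - vel U = - sqrt ((p - f0 * q \<tau>0) * (\<tau>0 - \<tau>))"
      unfolding rankine_hugoniot_def jump_def average_def p_def[symmetric] \<tau>_def[symmetric]
        \<tau>0_def[symmetric] drop sym neg_equal_0_iff_equal hug by simp
    then have "forward_shock E U A \<longleftrightarrow> \<tau> > a \<and> p = curve_pressure A \<tau> \<and> vel U = vel A + curve_velocity A \<tau>"
      using gt dens pA W unfolding forward_shock_def p_def[symmetric] by auto
    moreover have "\<not> backward_rarefaction E A U" "\<not> forward_rarefaction E U A" "A \<noteq> U"
      using dens by (auto simp: backward_rarefaction_def forward_rarefaction_def)
    ultimately show ?thesis by (auto simp: p_def \<tau>_def)
  next
    case False
    then have dens: "dens U \<le> dens A" "dens U = dens A \<longleftrightarrow> \<tau> = \<tau>0" "dens U < dens A \<longleftrightarrow> \<tau> > \<tau>0"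
      using assms by (auto simp: \<tau>_def \<tau>0_def volume_at_def field_simps)
    have P: "curve_pressure A \<tau> = f0 * q \<tau>"
      using False P0 by (cases "\<tau> = \<tau>0") (auto simp: curve_pressure_def Let_def \<tau>0_def f0_def)
    have W: "curve_velocity A \<tau> = sqrt f0 * (G \<tau>0 - G \<tau>)"
      using False by (cases "\<tau> = \<tau>0") (auto simp: curve_velocity_def Let_def \<tau>0_def f0_def)
    \<comment> \<open>Both pressures have the same positive factor \<open>q \<tau>\<close>, so they
      differ only through \<open>f\<close> of the entropy.\<close>
    have "p = curve_pressure A \<tau> \<longleftrightarrow> ent U = ent A"
      using p P q_pos[OF pos(1)] f_inj by (auto simp: f0_def inj_eq)
    moreover have "rarefaction_integral E (dens A) (ent A) - rarefaction_integral E (dens U) (ent A) =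
        - curve_velocity A \<tau>"
      unfolding W using assms
      by (simp add: rarefaction_integral_eq f0_def \<tau>_def \<tau>0_def volume_at_def algebra_simps)
    moreover have "curve_velocity A \<tau>0 = 0"
      by (simp add: curve_velocity_def Let_def \<tau>0_def)
    moreover have "\<not> backward_shock E A U" "\<not> forward_shock E U A"
      using dens by (auto simp: backward_shock_def forward_shock_def)
    moreover have "\<tau> > a" using False a by simp
    ultimately show ?thesis
      using False dens unfolding backward_rarefaction_def forward_rarefaction_def
        p_def[symmetric] \<tau>_def[symmetric]
      by (cases "\<tau> = \<tau>0") (auto simp: gas_state.expand)
  qed
  then show ?B ?F by auto
qed

text \<open>Solutions without vacuum correspond to crossings of the two wave curves. The crossing
  yields volumes, pressures and velocities, and bijectivity of \<open>f\<close> onto the positive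
  reals recovers the entropies.\<close>

lemma riemann_solution_unique:
  assumes "dens Ul > 0" "dens Ur > 0"
  shows "\<exists>!sol. riemann_solution E Ul Ur sol"
proof -
  obtain a where a: "0 < a" "a < volume_at Ul" "shock_factor (volume_at Ul) a = 0"
    using shock_factor_zero[of "volume_at Ul"] assms by (auto simp: volume_at_def)
  obtain b where b: "0 < b" "b < volume_at Ur" "shock_factor (volume_at Ur) b = 0"
    using shock_factor_zero[of "volume_at Ur"] assms by (auto simp: volume_at_def)
  note curves = wave_curve_of_state[OF assms(1) a] wave_curve_of_state[OF assms(2) b]
  note pos = wave_curveD(5)[OF curves(1)] wave_curveD(5)[OF curves(2)]
  define R where "R = (\<lambda>(x, y). x > a \<and> y > b \<and> curve_pressure Ul x = curve_pressure Ur y \<and>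
    curve_velocity Ul x + curve_velocity Ur y = vel Ul - vel Ur)"
  have "\<exists>!z. R z"
    using wave_curves_cross[OF curves] unfolding R_def .
  then obtain x y where xy: "R (x, y)" and uniq: "\<And>z. R z \<Longrightarrow> z = (x, y)"
    by (metis surj_pair)
  \<comment> \<open>The contact conditions become \<open>R\<close>: equal velocities mean that the
    two drops add up to \<open>vel Ul - vel Ur\<close>. The alternative \<open>U1 = U2\<close> is
    covered, since it satisfies both jump conditions.\<close>
  have sol_iff: "riemann_solution E Ul Ur (No_Vacuum U1 U2) \<longleftrightarrow>
      dens U1 > 0 \<and> dens U2 > 0 \<and> R (volume_at U1, volume_at U2) \<and>
      pressure_at E U1 = curve_pressure Ul (volume_at U1) \<and>
      pressure_at E U2 = curve_pressure Ur (volume_at U2) \<and>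
      vel U1 = vel Ul - curve_velocity Ul (volume_at U1) \<and>
      vel U2 = vel Ur + curve_velocity Ur (volume_at U2)" for U1 U2
  proof (cases "dens U1 > 0 \<and> dens U2 > 0")
    case True
    then show ?thesis
      using backward_wave_iff[OF assms(1) _ a, of U1] forward_wave_iff[OF assms(2) _ b, of U2]
      by (auto simp: R_def contact_def jump_def)
  qed auto
  have ent: "\<exists>S. pressure E \<tau> S = c" if "\<tau> > 0" "c > 0" for \<tau> c
    using f_onto[of "c / q \<tau>"] q_pos[of \<tau>] that by (auto simp: pressure_eq field_simps)
  have x: "x > a" "x > 0" and y: "y > b" "y > 0" using xy a b by (auto simp: R_def)
  obtain S1 S2 where S: "pressure E x S1 = curve_pressure Ul x" "pressure E y S2 = curve_pressure Ur y"
    using ent[of x] ent[of y] pos x y by meson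
  define U1 where "U1 = State (1 / x) (vel Ul - curve_velocity Ul x) S1"
  define U2 where "U2 = State (1 / y) (vel Ur + curve_velocity Ur y) S2"
  have U: "riemann_solution E Ul Ur (No_Vacuum U1 U2)"
    unfolding sol_iff using xy x y S by (simp add: U1_def U2_def volume_at_def pressure_at_def)
  have same: "V = V'" if "volume_at V = volume_at V'" "volume_at V > 0"
      "pressure_at E V = pressure_at E V'" "vel V = vel V'" for V V'
  proof -
    have "f (ent V) * q (volume_at V) = f (ent V') * q (volume_at V)"
      using that by (simp add: pressure_at_def pressure_eq)
    then have "ent V = ent V'" using q_pos[OF that(2)] f_inj by (simp add: inj_eq)
    then show ?thesis using that by (simp add: gas_state.expand volume_at_def)
  qed
  show ?thesis
  proof (rule ex1I[of _ "No_Vacuum U1 U2"])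
    show "riemann_solution E Ul Ur (No_Vacuum U1 U2)" by (fact U)
    fix sol assume sol: "riemann_solution E Ul Ur sol"
    show "sol = No_Vacuum U1 U2"
    proof (cases sol)
      case (No_Vacuum V1 V2)
      note V = sol[unfolded No_Vacuum sol_iff] and U = U[unfolded sol_iff]
      have "(volume_at V1, volume_at V2) = (x, y)" "(volume_at U1, volume_at U2) = (x, y)"
        using V U uniq by blast+
      then have "V1 = U1" "V2 = U2"
        using V U x y by (auto intro!: same)
      then show ?thesis by (simp add: No_Vacuum)
    next
      case (Vacuum ul ur)
      then show ?thesis using sol not_riemann_solution_Vacuum by blast
    qed
  qed
qed

lemma riemann_solution_no_vacuum:
  "riemann_solution E Ul Ur sol \<Longrightarrow> \<not> contains_vacuum sol"
  using not_riemann_solution_Vacuum by (cases sol) auto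

end

section \<open>Antiderivatives and integrals over half-lines\<close>

text \<open>The fundamental theorem for nonnegative integrals gives a finite value, from which
  integrability and the Bochner integral follow together.\<close>

lemma has_bochner_integral_FTC_atLeast:
  fixes g F :: "real \<Rightarrow> real"
  assumes cont: "continuous_on {a..} g"
    and F: "\<And>x. a \<le> x \<Longrightarrow> (F has_real_derivative g x) (at x)"
    and nonneg: "\<And>x. a \<le> x \<Longrightarrow> 0 \<le> g x"
    and lim: "(F \<longlongrightarrow> T) at_top"
  shows "set_integrable lborel {a..} g" "(LBINT x:{a..}. g x) = T - F a"
proof -
  \<comment> \<open>Cutting off with the indicator gives a function measurable on the whole line,
    although \<open>g\<close> is controlled only on \<open>{a..}\<close>.\<close>
  define h where "h = (\<lambda>x. indicator {a..} x *\<^sub>R g x)"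
  have h: "h \<in> borel_measurable borel"
    unfolding h_def using cont by (intro borel_measurable_continuous_on_indicator) auto
  have "(\<integral>\<^sup>+x. ennreal (h x) * indicator {a..} x \<partial>lborel) = ennreal (T - F a)"
    by (rule nn_integral_FTC_atLeast[OF h _ _ lim]) (use F nonneg in \<open>auto simp: h_def\<close>)
  also have "(\<lambda>x. ennreal (h x) * indicator {a..} x) = (\<lambda>x. ennreal (h x))"
    by (auto simp: h_def indicator_def)
  finally have nn: "(\<integral>\<^sup>+x. ennreal (h x) \<partial>lborel) = ennreal (T - F a)" .
  \<comment> \<open>\<open>ennreal\<close> sends negative numbers to 0, so \<open>T - F a\<close>
    must be shown nonnegative before its value can be read back.\<close>
  have "F a \<le> F x" if "a \<le> x" for x
  proof (rule DERIV_nonneg_imp_nondecreasing[OF that])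
    fix z assume "a \<le> z"
    then show "\<exists>d. (F has_real_derivative d) (at z) \<and> 0 \<le> d"
      using F nonneg by blast
  qed
  then have "F a \<le> T"
    by (intro tendsto_lowerbound[OF lim eventually_mono[OF eventually_ge_at_top]]) auto
  moreover have "\<And>x. 0 \<le> h x" using nonneg by (auto simp: h_def indicator_def)
  ultimately have "has_bochner_integral lborel h (T - F a)"
    using nn h by (intro has_bochner_integral_nn_integral) auto
  then show "set_integrable lborel {a..} g" "(LBINT x:{a..}. g x) = T - F a"
    unfolding set_integrable_def set_lebesgue_integral_def h_def has_bochner_integral_iff by auto
qed

lemma antiderivative_pos:
  fixes g :: "real \<Rightarrow> real"
  assumes "continuous_on {0<..} g"
  obtains F where "\<And>x. x > 0 \<Longrightarrow> (F has_real_derivative g x) (at x)"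
proof -
  have "isCont g x" if "ereal 0 < ereal x" for x
    using assms that by (simp add: continuous_on_eq_continuous_at)
  then have "\<exists>F. \<forall>x. ereal 0 < ereal x \<longrightarrow> ereal x < \<infinity> \<longrightarrow> (F has_vector_derivative g x) (at x)"
    by (intro einterval_antiderivative) auto
  then show ?thesis using that by (auto simp flip: has_real_derivative_iff_has_vector_derivative)
qed

text \<open>This dichotomy translates convergence or divergence of an integral into the behaviour of
  an antiderivative.\<close>

lemma mono_tendsto_or_at_top:
  fixes F :: "real \<Rightarrow> real"
  assumes mono: "\<And>x y. a \<le> x \<Longrightarrow> x \<le> y \<Longrightarrow> F x \<le> F y"
  obtains "filterlim F at_top at_top" | T where "(F \<longlongrightarrow> T) at_top" "\<And>x. a \<le> x \<Longrightarrow> F x \<le> T"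
proof (cases "bdd_above (F ` {a..})")
  case True
  define T where "T = (SUP x\<in>{a..}. F x)"
  have le: "F x \<le> T" if "a \<le> x" for x
    unfolding T_def using that True by (intro cSUP_upper) auto
  have "(F \<longlongrightarrow> T) at_top"
  proof (rule order_tendstoI)
    fix y assume "y < T"
    then obtain x where "a \<le> x" "y < F x"
      unfolding T_def using less_cSUP_iff[OF _ True] by auto
    then show "eventually (\<lambda>x. y < F x) at_top"
      using mono by (intro eventually_mono[OF eventually_ge_at_top[of x]]) (auto intro: less_le_trans)
  next
    fix y assume "T < y"
    then show "eventually (\<lambda>x. F x < y) at_top"
      using le by (intro eventually_mono[OF eventually_ge_at_top[of a]]) (auto intro: le_less_trans)
  qed
  then show ?thesis using le that by blast
next
  case False
  have "eventually (\<lambda>x. Z \<le> F x) at_top" for Z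
  proof -
    obtain x where "a \<le> x" "Z < F x"
      using False unfolding bdd_above_def by (auto simp: not_le)
    then show ?thesis
      using mono by (intro eventually_mono[OF eventually_ge_at_top[of x]]) (meson less_imp_le order_trans)
  qed
  then show ?thesis using that unfolding filterlim_at_top by blast
qed

text \<open>For an antiderivative \<open>F\<close> with limit \<open>T\<close> the tail is
  \<open>T - F y\<close>, and all three claims can be read off. The limit exists by integrability
  from 1 onwards, but the formula reaches every \<open>y > 0\<close>.\<close>

lemma tail_integral:
  fixes g :: "real \<Rightarrow> real"
  assumes cont: "continuous_on {0<..} g" and nonneg: "\<And>x. x > 0 \<Longrightarrow> g x \<ge> 0"
    and int: "set_integrable lborel {1..} g"
  shows tail_integral_deriv:
      "y > 0 \<Longrightarrow> ((\<lambda>y. LBINT z:{y..}. g z) has_real_derivative - g y) (at y)"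
    and tail_integral_tendsto: "((\<lambda>y. LBINT z:{y..}. g z) \<longlongrightarrow> 0) at_top"
    and tail_integral_nonneg: "y > 0 \<Longrightarrow> (LBINT z:{y..}. g z) \<ge> 0"
proof -
  obtain F where F: "\<And>x. x > 0 \<Longrightarrow> (F has_real_derivative g x) (at x)"
    using antiderivative_pos[OF cont] by blast
  have sub: "continuous_on {a..} g" if "a > 0" for a
    using that by (intro continuous_on_subset[OF cont]) auto
  have mono: "F x \<le> F y" if "1 \<le> x" "x \<le> y" for x y
  proof (rule DERIV_nonneg_imp_nondecreasing[OF that(2)])
    fix z assume "x \<le> z"
    then show "\<exists>d. (F has_real_derivative d) (at z) \<and> 0 \<le> d"
      using F[of z] nonneg[of z] that by (intro exI[of _ "g z"]) auto
  qed
  \<comment> \<open>The increments of \<open>F\<close> beyond 1 are bounded by the integral of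
    \<open>g\<close> over \<open>{1..}\<close>.\<close>
  have not_top: "\<not> filterlim F at_top at_top"
  proof
    assume top: "filterlim F at_top at_top"
    define B where "B = (LBINT z:{1..}. g z)"
    have "F x - F 1 \<le> B" if "x \<ge> 1" for x
    proof -
      have "continuous_on {1..x} g" by (rule continuous_on_subset[OF cont]) auto
      moreover have "(F has_vector_derivative g z) (at z within {1..x})" if "1 \<le> z" for z
        using that F[of z]
        by (simp add: has_field_derivative_at_within flip: has_real_derivative_iff_has_vector_derivative)
      ultimately have "F x - F 1 = (LBINT z:{1..x}. g z)"
        unfolding set_lebesgue_integral_def using \<open>1 \<le> x\<close>
        by (intro integral_FTC_atLeastAtMost[symmetric]) auto
      also have "\<dots> \<le> B"
        unfolding B_def set_lebesgue_integral_def
      proof (rule integral_mono)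
        show "integrable lborel (\<lambda>z. indicat_real {1..x} z *\<^sub>R g z)"
          using set_integrable_subset[OF int, of "{1..x}"] by (simp add: set_integrable_def)
        show "integrable lborel (\<lambda>z. indicat_real {1..} z *\<^sub>R g z)"
          using int by (simp add: set_integrable_def)
      qed (use nonneg in \<open>auto simp: indicator_def\<close>)
      finally show ?thesis .
    qed
    moreover have "eventually (\<lambda>x. B + F 1 < F x) at_top"
      using top unfolding filterlim_at_top_dense by blast
    then obtain x where "1 < x" "B + F 1 < F x" by (rule at_top_witness)
    ultimately show False by (meson diff_le_eq less_imp_le not_le)
  qed
  obtain T where T: "(F \<longlongrightarrow> T) at_top" "\<And>x. 1 \<le> x \<Longrightarrow> F x \<le> T"
    by (rule mono_tendsto_or_at_top[of 1 F]) (use mono not_top in auto)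
  have eq: "(LBINT z:{y..}. g z) = T - F y" if "y > 0" for y
    using that F nonneg T(1) sub[of y]
    by (intro has_bochner_integral_FTC_atLeast) auto
  show "((\<lambda>y. LBINT z:{y..}. g z) has_real_derivative - g y) (at y)" if "y > 0" for y
  proof (rule has_field_derivative_transform_within_open[of "\<lambda>y. T - F y" _ _ "{0<..}"])
    show "((\<lambda>y. T - F y) has_real_derivative - g y) (at y)"
      using F[OF that] by (auto intro!: derivative_eq_intros)
  qed (use that eq in auto)
  have "((\<lambda>y. T - F y) \<longlongrightarrow> T - T) at_top" by (intro tendsto_intros T)
  then show "((\<lambda>y. LBINT z:{y..}. g z) \<longlongrightarrow> 0) at_top"
    by (rule filterlim_mono_eventually)
       (use eq in \<open>auto intro!: eventually_mono[OF eventually_gt_at_top[of 0]]\<close>)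
  show "(LBINT z:{y..}. g z) \<ge> 0" if "y > 0" for y
    unfolding set_lebesgue_integral_def
    using that nonneg by (intro Bochner_Integration.integral_nonneg) (auto simp: indicator_def)
qed

text \<open>A finite limit of \<open>F\<close> would make \<open>g\<close> integrable on
  \<open>{1..}\<close>.\<close>

lemma antiderivative_at_top:
  fixes g F :: "real \<Rightarrow> real"
  assumes cont: "continuous_on {0<..} g" and pos: "\<And>x. x > 0 \<Longrightarrow> g x > 0"
    and F: "\<And>x. x > 0 \<Longrightarrow> (F has_real_derivative g x) (at x)"
    and inf: "(\<integral>\<^sup>+ y\<in>{1..}. ennreal (g y) \<partial>lborel) = \<infinity>"
  shows "filterlim F at_top at_top"
proof (rule mono_tendsto_or_at_top[of 1 F])
  show "F x \<le> F y" if "1 \<le> x" "x \<le> y" for x y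
  proof (rule DERIV_nonneg_imp_nondecreasing[OF that(2)])
    fix z assume "x \<le> z"
    then show "\<exists>d. (F has_real_derivative d) (at z) \<and> 0 \<le> d"
      using F[of z] pos[of z] that by (intro exI[of _ "g z"]) auto
  qed
next
  fix T assume T: "(F \<longlongrightarrow> T) at_top"
  have cont1: "continuous_on {1..} g" by (rule continuous_on_subset[OF cont]) auto
  have "set_integrable lborel {1..} g"
    by (rule has_bochner_integral_FTC_atLeast[OF cont1 _ _ T]) (use F pos in \<open>simp_all add: less_imp_le\<close>)
  then have "integrable lborel (\<lambda>x. indicator {1..} x *\<^sub>R g x)" by (simp add: set_integrable_def)
  then have "(\<integral>\<^sup>+ x. ennreal (norm (indicator {1..} x *\<^sub>R g x)) \<partial>lborel) < \<infinity>"
    unfolding integrable_iff_bounded by simp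
  moreover have "(\<lambda>x. ennreal (norm (indicator {1..} x *\<^sub>R g x))) =
      (\<lambda>x. ennreal (g x) * indicator {1..} x)"
    using pos by (auto simp: indicator_def abs_of_pos)
  ultimately show ?thesis using inf by simp
qed

lemma C2_on_derivs:
  assumes "C2_on g A" "open A"
  shows "x \<in> A \<Longrightarrow> (g has_real_derivative deriv g x) (at x)"
    and "x \<in> A \<Longrightarrow> (deriv g has_real_derivative deriv (deriv g) x) (at x)"
    and "continuous_on A (deriv (deriv g))"
proof -
  have *: "(\<forall>x\<in>A. (h has_real_derivative deriv h x) (at x)) \<and> continuous_on A (deriv h)"
    if h: "h C1_differentiable_on A" for h :: "real \<Rightarrow> real"
  proof -
    obtain D where D: "\<And>x. x \<in> A \<Longrightarrow> (h has_real_derivative D x) (at x)" "continuous_on A D"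
      using h unfolding C1_differentiable_on_def
      by (auto simp flip: has_real_derivative_iff_has_vector_derivative)
    then have eq: "deriv h x = D x" if "x \<in> A" for x using that by (intro DERIV_imp_deriv)
    have "continuous_on A (deriv h)" using D(2) by (rule continuous_on_eq) (simp add: eq)
    then show ?thesis using D(1) eq by simp
  qed
  show "x \<in> A \<Longrightarrow> (g has_real_derivative deriv g x) (at x)"
    "x \<in> A \<Longrightarrow> (deriv g has_real_derivative deriv (deriv g) x) (at x)"
    "continuous_on A (deriv (deriv g))"
    using assms *[of g] *[of "deriv g"] by (auto simp: C2_on_def)
qed

text \<open>By convexity \<open>k\<close> lies above its tangent at \<open>y\<close>, which stays
  nonnegative up to its root. The bound is the integral of the squared tangent between
  \<open>y\<close> and that root; \<open>I\<close> plays the role of the tail integral of the square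
  of \<open>k\<close>.\<close>

lemma tangent_square_bound:
  fixes k k' k'' I :: "real \<Rightarrow> real"
  assumes k: "\<And>y. y > 0 \<Longrightarrow> (k has_real_derivative k' y) (at y)"
    and k': "\<And>y. y > 0 \<Longrightarrow> (k' has_real_derivative k'' y) (at y)"
    and k_pos: "\<And>y. y > 0 \<Longrightarrow> k y > 0" and k'_neg: "\<And>y. y > 0 \<Longrightarrow> k' y < 0"
    and k''_nonneg: "\<And>y. y > 0 \<Longrightarrow> k'' y \<ge> 0"
    and I: "\<And>y. y > 0 \<Longrightarrow> (I has_real_derivative - (k y)\<^sup>2) (at y)"
    and I_nonneg: "\<And>y. y > 0 \<Longrightarrow> I y \<ge> 0" and y: "y > 0"
  shows "I y \<ge> (k y) ^ 3 / (3 * - k' y)"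
proof -
  have convex: "convex_on {0<..} k"
    by (rule f''_ge0_imp_convex[where f' = k' and f'' = k'']) (use k k' k''_nonneg in auto)
  have tangent: "k z \<ge> k y + k' y * (z - y)" if "z > 0" for z
    using convex_on_imp_above_tangent[OF convex, of y z "k' y"] k[OF y] y that
    by (auto simp: has_field_derivative_at_within interior_open)
  \<comment> \<open>The tangent at \<open>y\<close> has its root at \<open>y + L\<close>.\<close>
  define L where "L = k y / - k' y"
  have L: "L > 0" "k y + k' y * L = 0" using k_pos[OF y] k'_neg[OF y] by (auto simp: L_def divide_pos_neg)
  \<comment> \<open>This is \<open>I z\<close> minus the integral of the squared tangent from
    \<open>z\<close> to \<open>y + L\<close>. It decreases up to \<open>y + L\<close>, where only
    \<open>I\<close> remains.\<close>
  define N where "N = (\<lambda>z. I z + (k y + k' y * (z - y)) ^ 3 / (3 * k' y))"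
  have "N (y + L) \<le> N y"
  proof (rule DERIV_nonpos_imp_nonincreasing[of y "y + L" N])
    fix z assume z: "y \<le> z" "z \<le> y + L"
    then have "z > 0" using y by simp
    have "(N has_real_derivative - (k z)\<^sup>2 + (k y + k' y * (z - y))\<^sup>2) (at z)"
      unfolding N_def using k'_neg[OF y] I[OF \<open>z > 0\<close>]
      by (auto intro!: derivative_eq_intros simp: power2_eq_square)
    \<comment> \<open>The tangent is nonnegative before its root, so the comparison with
      \<open>k\<close> survives squaring.\<close>
    moreover have "k y + k' y * (z - y) \<ge> k y + k' y * L"
      using z k'_neg[OF y] by (intro add_left_mono mult_left_mono_neg) auto
    then have "(k y + k' y * (z - y))\<^sup>2 \<le> (k z)\<^sup>2"
      using tangent[OF \<open>z > 0\<close>] L by (intro power_mono) auto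
    ultimately show "\<exists>d. (N has_real_derivative d) (at z) \<and> d \<le> 0" by force
  qed (use L in simp)
  moreover have "N (y + L) \<ge> 0" using I_nonneg[of "y + L"] L y by (simp add: N_def)
  ultimately show ?thesis by (simp add: N_def)
qed

section \<open>Internal energy given by a convex kernel\<close>

lemma product_partials:
  fixes F :: "real \<Rightarrow> real \<Rightarrow> real" and u w u' w' :: "real \<Rightarrow> real"
  assumes F: "\<And>\<tau> S. \<tau> > 0 \<Longrightarrow> F \<tau> S = u S * w \<tau>"
    and u: "\<And>S. (u has_real_derivative u' S) (at S)"
    and w: "\<And>\<tau>. \<tau> > 0 \<Longrightarrow> (w has_real_derivative w' \<tau>) (at \<tau>)"
  shows partial1_product: "\<tau> > 0 \<Longrightarrow> partial1 F \<tau> S = u S * w' \<tau>"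
    and partial2_product: "\<tau> > 0 \<Longrightarrow> partial2 F \<tau> S = u' S * w \<tau>"
    and plane_C1_on_product: "continuous_on UNIV u' \<Longrightarrow> continuous_on {0<..} w' \<Longrightarrow>
      plane_C1_on F ({0<..} \<times> UNIV)"
proof -
  have d1: "((\<lambda>t. F t S) has_real_derivative u S * w' \<tau>) (at \<tau>)" if "\<tau> > 0" for \<tau> S
    by (rule has_field_derivative_transform_within_open[OF DERIV_cmult[OF w[OF that]], of "{0<..}"])
       (use that F in auto)
  have d2: "((\<lambda>t. F \<tau> t) has_real_derivative u' S * w \<tau>) (at S)" if "\<tau> > 0" for \<tau> S
    by (rule has_field_derivative_transform_within_open[OF DERIV_cmult_right[OF u], of UNIV])
       (use that F in auto)
  show p1: "partial1 F \<tau> S = u S * w' \<tau>" if "\<tau> > 0" for \<tau> S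
    using d1[OF that] by (simp add: partial1_def DERIV_imp_deriv)
  show p2: "partial2 F \<tau> S = u' S * w \<tau>" if "\<tau> > 0" for \<tau> S
    using d2[OF that] by (simp add: partial2_def DERIV_imp_deriv)
  have cu: "continuous_on UNIV u"
    using u by (intro continuous_at_imp_continuous_on) (auto intro: DERIV_isCont)
  have cw: "continuous_on {0<..} w"
    using w by (intro continuous_at_imp_continuous_on) (auto intro: DERIV_isCont)
  have prod: "continuous_on ({0<..} \<times> UNIV) (\<lambda>(x, y). H x y)"
    if "continuous_on UNIV a" "continuous_on {0<..} b" "\<And>\<tau> S. \<tau> > 0 \<Longrightarrow> H \<tau> S = a S * b \<tau>"
    for a b :: "real \<Rightarrow> real" and H
  proof (rule continuous_on_eq)
    show "continuous_on ({0<..} \<times> UNIV) (\<lambda>z. a (snd z) * b (fst z))"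
      by (intro continuous_intros continuous_on_compose2[OF that(1)] continuous_on_compose2[OF that(2)])
         auto
  qed (use that(3) in auto)
  show "plane_C1_on F ({0<..} \<times> UNIV)" if "continuous_on UNIV u'" "continuous_on {0<..} w'"
    unfolding plane_C1_on_def
  proof (intro conjI)
    show "\<forall>(x, y)\<in>{0<..} \<times> UNIV. (\<lambda>t. F t y) field_differentiable at x \<and>
        (\<lambda>t. F x t) field_differentiable at y"
      using d1 d2 unfolding field_differentiable_def by blast
    show "continuous_on ({0<..} \<times> UNIV) (\<lambda>(x, y). F x y)" by (rule prod[OF cu cw F])
    show "continuous_on ({0<..} \<times> UNIV) (\<lambda>(x, y). partial1 F x y)" by (rule prod[OF cu that(2) p1])
    show "continuous_on ({0<..} \<times> UNIV) (\<lambda>(x, y). partial2 F x y)" by (rule prod[OF that(1) cw p2])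
  qed
qed

locale gas_kernel =
  fixes k k' k'' :: "real \<Rightarrow> real"
  assumes k_deriv: "y > 0 \<Longrightarrow> (k has_real_derivative k' y) (at y)"
    and k'_deriv: "y > 0 \<Longrightarrow> (k' has_real_derivative k'' y) (at y)"
    and k_pos: "y > 0 \<Longrightarrow> k y > 0"
    and k'_neg: "y > 0 \<Longrightarrow> k' y < 0"
    and k''_pos: "y > 0 \<Longrightarrow> k'' y > 0"
    and k_sq_integrable: "set_integrable lborel {1..} (\<lambda>y. (k y)\<^sup>2)"
    and k_not_integrable: "(\<integral>\<^sup>+ y\<in>{1..}. ennreal (k y) \<partial>lborel) = \<infinity>"
    and k_at_0: "filterlim k at_top (at_right 0)"
    and k_log_deriv_at_0: "filterlim (\<lambda>y. k' y / k y) at_bot (at_right 0)"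
begin

definition tail :: "real \<Rightarrow> real" where
  "tail y = (LBINT z:{y..}. (k z)\<^sup>2)"

definition energy_factor :: "real \<Rightarrow> real" where
  "energy_factor \<tau> = tail (ln (\<tau> + 1))"

definition pressure_factor :: "real \<Rightarrow> real" where
  "pressure_factor \<tau> = (k (ln (\<tau> + 1)))\<^sup>2 / (\<tau> + 1)"

definition pressure_factor' :: "real \<Rightarrow> real" where
  "pressure_factor' \<tau> =
     (2 * k (ln (\<tau> + 1)) * k' (ln (\<tau> + 1)) - (k (ln (\<tau> + 1)))\<^sup>2) / (\<tau> + 1)\<^sup>2"

lemma k_cont: "continuous_on {0<..} k"
  using k_deriv by (intro continuous_at_imp_continuous_on) (auto intro: DERIV_isCont)

lemma k'_cont: "continuous_on {0<..} k'"
  using k'_deriv by (intro continuous_at_imp_continuous_on) (auto intro: DERIV_isCont)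

lemma k_sq_cont: "continuous_on {0<..} (\<lambda>y. (k y)\<^sup>2)"
  by (intro continuous_intros k_cont)

lemma tail_deriv: "y > 0 \<Longrightarrow> (tail has_real_derivative - (k y)\<^sup>2) (at y)"
  unfolding tail_def[abs_def] by (rule tail_integral_deriv[OF k_sq_cont _ k_sq_integrable]) auto

lemma tail_at_top: "(tail \<longlongrightarrow> 0) at_top"
  unfolding tail_def[abs_def] by (rule tail_integral_tendsto[OF k_sq_cont _ k_sq_integrable]) auto

lemma tail_nonneg: "y > 0 \<Longrightarrow> tail y \<ge> 0"
  unfolding tail_def by (rule tail_integral_nonneg[OF k_sq_cont _ k_sq_integrable]) auto

lemma tail_bound: "y > 0 \<Longrightarrow> tail y \<ge> (k y) ^ 3 / (3 * - k' y)"
  by (rule tangent_square_bound[OF k_deriv k'_deriv k_pos k'_neg _ tail_deriv tail_nonneg])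
     (auto simp: k''_pos less_imp_le)

text \<open>The tangent bound is itself positive.\<close>

lemma tail_pos: "y > 0 \<Longrightarrow> tail y > 0"
  using tail_bound[of y] k_pos[of y] k'_neg[of y]
  by (intro less_le_trans[OF _ tail_bound] divide_pos_pos) auto

lemma k_less: "0 < s \<Longrightarrow> s < t \<Longrightarrow> k t < k s"
  by (rule DERIV_neg_imp_decreasing[of s t k]) (auto intro!: exI k_deriv k'_neg)

section \<open>Energy and pressure factors under the substitution
  \<open>y = ln (\<tau> + 1)\<close>\<close>

lemma ln_shift_deriv:
  "\<tau> > 0 \<Longrightarrow> ((\<lambda>\<tau>. ln (\<tau> + 1)) has_real_derivative 1 / (\<tau> + 1)) (at \<tau>)" for \<tau> :: real
  by (auto intro!: derivative_eq_intros)

lemma ln_shift_pos: "\<tau> > 0 \<Longrightarrow> ln (\<tau> + 1) > 0" for \<tau> :: real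
  by simp

lemma ln_shift_at_0: "filterlim (\<lambda>\<tau>. ln (\<tau> + 1)) (at_right 0) (at_right (0 :: real))"
proof -
  have "((\<lambda>\<tau>. ln (\<tau> + 1)) \<longlongrightarrow> ln (0 + 1)) (at_right (0 :: real))"
    by (intro tendsto_intros) auto
  then show ?thesis
    unfolding filterlim_at
    by (auto intro!: eventually_mono[OF eventually_at_right_less])
qed

lemma add_one_at_top: "filterlim (\<lambda>\<tau>. \<tau> + 1) at_top (at_top :: real filter)"
  by (simp only: add.commute[of _ "1 :: real"]) (rule filterlim_tendsto_add_at_top[OF tendsto_const filterlim_ident])

lemma ln_shift_at_top: "filterlim (\<lambda>\<tau>. ln (\<tau> + 1)) at_top (at_top :: real filter)"
  by (rule filterlim_compose[OF ln_at_top add_one_at_top])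

lemma energy_factor_deriv:
  assumes "\<tau> > 0"
  shows "(energy_factor has_real_derivative - pressure_factor \<tau>) (at \<tau>)"
  using DERIV_chain2[OF tail_deriv[OF ln_shift_pos] ln_shift_deriv, OF assms assms]
  by (simp add: energy_factor_def[abs_def] pressure_factor_def)

lemma energy_factor_pos: "\<tau> > 0 \<Longrightarrow> energy_factor \<tau> > 0"
  by (simp add: energy_factor_def tail_pos)

lemma energy_factor_at_top: "(energy_factor \<longlongrightarrow> 0) at_top"
  unfolding energy_factor_def[abs_def] by (rule filterlim_compose[OF tail_at_top ln_shift_at_top])

lemma pressure_factor_pos: "\<tau> > 0 \<Longrightarrow> pressure_factor \<tau> > 0"
  using k_pos[of "ln (\<tau> + 1)"] by (simp add: pressure_factor_def)

lemma pressure_factor_deriv: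
  assumes "\<tau> > 0"
  shows "(pressure_factor has_real_derivative pressure_factor' \<tau>) (at \<tau>)"
proof -
  have "((\<lambda>\<tau>. k (ln (\<tau> + 1))) has_real_derivative k' (ln (\<tau> + 1)) * (1 / (\<tau> + 1))) (at \<tau>)"
    by (rule DERIV_chain2[OF k_deriv[OF ln_shift_pos] ln_shift_deriv]) (use assms in auto)
  from DERIV_divide[OF DERIV_power[OF this, of 2] DERIV_add[OF DERIV_ident DERIV_const[of 1]]]
  show ?thesis
    unfolding pressure_factor_def[abs_def] pressure_factor'_def
  proof (rule DERIV_cong)
    have "2 * (b * (1 / s) * a) * s - a\<^sup>2 = 2 * a * b - a\<^sup>2" if "s > 0" for a b s :: real
      using that by (simp add: field_simps)
    from this[of "\<tau> + 1" "k' (ln (\<tau> + 1))" "k (ln (\<tau> + 1))"]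
    \<comment> \<open>The left side is the unsimplified output of the power and quotient
      rules.\<close>
    show "(of_nat 2 * (k' (ln (\<tau> + 1)) * (1 / (\<tau> + 1)) * k (ln (\<tau> + 1)) ^ (2 - Suc 0)) * (\<tau> + 1) -
        (k (ln (\<tau> + 1)))\<^sup>2 * (1 + 0)) / ((\<tau> + 1) * (\<tau> + 1)) =
        (2 * k (ln (\<tau> + 1)) * k' (ln (\<tau> + 1)) - (k (ln (\<tau> + 1)))\<^sup>2) / (\<tau> + 1)\<^sup>2"
      using assms by (simp add: power2_eq_square)
  qed (use assms in auto)
qed

lemma pressure_factor'_neg: "\<tau> > 0 \<Longrightarrow> pressure_factor' \<tau> < 0"
  using k_pos[of "ln (\<tau> + 1)"] k'_neg[of "ln (\<tau> + 1)"] unfolding pressure_factor'_def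
  by (intro divide_neg_pos) (auto simp: mult_pos_neg intro: less_trans[of _ 0])

lemma pressure_factor'_cont: "continuous_on {0<..} pressure_factor'"
  unfolding pressure_factor'_def[abs_def]
  by (intro continuous_intros continuous_on_compose2[OF k_cont] continuous_on_compose2[OF k'_cont]) auto

text \<open>After clearing \<open>(\<tau> + 1)\<^sup>2\<close>, the tangent bound gives
  \<open>k ^ 4\<close> at most \<open>3 * tail * k * (- k')\<close>, while the right side contains
  the same product with coefficient 4. The gap provides strictness.\<close>

lemma factor_shock_monotone:
  assumes "\<tau> > 0"
  shows "(pressure_factor \<tau>)\<^sup>2 < 2 * energy_factor \<tau> * (- pressure_factor' \<tau>)"
proof -
  define y where "y = ln (\<tau> + 1)"
  have y: "y > 0" using assms by (simp add: y_def)
  note pos = k_pos[OF y] k'_neg[OF y] tail_pos[OF y]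
  have "k y ^ 3 \<le> 3 * tail y * - k' y"
    using tail_bound[OF y] pos by (simp add: field_simps)
  then have "k y * k y ^ 3 \<le> k y * (3 * tail y * - k' y)"
    using pos by (intro mult_left_mono) auto
  also have "\<dots> < k y * (4 * tail y * - k' y)"
    using pos by (intro mult_strict_left_mono) (auto simp: mult_pos_neg)
  also have "\<dots> \<le> 2 * tail y * ((k y)\<^sup>2 - 2 * k y * k' y)"
    using pos by (simp add: algebra_simps)
  finally have "k y ^ 4 < 2 * tail y * ((k y)\<^sup>2 - 2 * k y * k' y)"
    by (simp add: power_numeral_reduce)
  then have "k y ^ 4 / (\<tau> + 1)\<^sup>2 < 2 * tail y * ((k y)\<^sup>2 - 2 * k y * k' y) / (\<tau> + 1)\<^sup>2"
    using assms by (intro divide_strict_right_mono) auto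
  also have "\<dots> = 2 * tail y * - ((2 * k y * k' y - (k y)\<^sup>2) / (\<tau> + 1)\<^sup>2)"
    by (simp add: diff_divide_distrib algebra_simps)
  finally show ?thesis
    by (simp add: pressure_factor_def energy_factor_def pressure_factor'_def power_divide flip: y_def)
qed

text \<open>Once \<open>ln (\<tau> + 1) > 1\<close>, the kernel is below \<open>k 1\<close> and the
  factor \<open>1 / (\<tau> + 1)\<close> supplies the decay.\<close>

lemma pressure_factor_at_top: "(pressure_factor \<longlongrightarrow> 0) at_top"
proof (rule tendsto_sandwich[OF _ _ tendsto_const])
  have pos: "eventually (\<lambda>\<tau>::real. \<tau> > 0) at_top" by (rule eventually_gt_at_top)
  have "eventually (\<lambda>\<tau>::real. ln (\<tau> + 1) > 1) at_top"
    using ln_shift_at_top unfolding filterlim_at_top_dense by blast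
  with pos show "eventually (\<lambda>\<tau>. pressure_factor \<tau> \<le> (k 1)\<^sup>2 / (\<tau> + 1)) at_top"
  proof eventually_elim
    case (elim \<tau>)
    then have "k (ln (\<tau> + 1)) < k 1" "k (ln (\<tau> + 1)) > 0" using k_less[of 1] k_pos by auto
    then show ?case using elim unfolding pressure_factor_def by (intro divide_right_mono power_mono) auto
  qed
  show "eventually (\<lambda>\<tau>. 0 \<le> pressure_factor \<tau>) at_top"
    using pos by eventually_elim (simp add: less_imp_le pressure_factor_pos)
  show "((\<lambda>\<tau>. (k 1)\<^sup>2 / (\<tau> + 1)) \<longlongrightarrow> 0) at_top"
    by (rule real_tendsto_divide_at_top[OF tendsto_const add_one_at_top])
qed

lemma pressure_factor_at_0: "filterlim pressure_factor at_top (at_right 0)"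
proof -
  have k: "filterlim (\<lambda>\<tau>. k (ln (\<tau> + 1))) at_top (at_right 0)"
    by (rule filterlim_compose[OF k_at_0 ln_shift_at_0])
  have "((\<lambda>\<tau>. 1 / (\<tau> + 1)) \<longlongrightarrow> 1 / (0 + 1)) (at_right (0 :: real))"
    by (intro tendsto_intros) auto
  then have "filterlim (\<lambda>\<tau>. 1 / (\<tau> + 1) * (k (ln (\<tau> + 1)) * k (ln (\<tau> + 1)))) at_top (at_right 0)"
    by (rule filterlim_tendsto_pos_mult_at_top[OF _ _ filterlim_at_top_mult_at_top[OF k k]]) auto
  then show ?thesis by (simp add: pressure_factor_def[abs_def] power2_eq_square)
qed

text \<open>By l'Hopital the limit is that of \<open>(\<tau> + 1) / (1 - 2 * k' / k)\<close>, which
  vanishes because \<open>k' / k\<close> tends to minus infinity. The form of the rule used asks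
  only for an infinite denominator, so the energy may be bounded or unbounded at 0.\<close>

lemma energy_pressure_ratio_at_0: "((\<lambda>\<tau>. energy_factor \<tau> / pressure_factor \<tau>) \<longlongrightarrow> 0) (at_right 0)"
proof (rule lhopital_right_0_at_top[OF pressure_factor_at_0])
  have pos: "eventually (\<lambda>\<tau>::real. \<tau> > 0) (at_right 0)" by (rule eventually_at_right_less)
  show "eventually (\<lambda>\<tau>. pressure_factor' \<tau> \<noteq> 0) (at_right 0)"
    using pos by eventually_elim (use pressure_factor'_neg in force)
  show "eventually (\<lambda>\<tau>. (energy_factor has_real_derivative - pressure_factor \<tau>) (at \<tau>)) (at_right 0)"
    using pos by eventually_elim (rule energy_factor_deriv)
  show "eventually (\<lambda>\<tau>. (pressure_factor has_real_derivative pressure_factor' \<tau>) (at \<tau>)) (at_right 0)"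
    using pos by eventually_elim (rule pressure_factor_deriv)
  have "filterlim (\<lambda>y. 2 * (- (k' y / k y))) at_top (at_right 0)"
    using k_log_deriv_at_0 unfolding filterlim_uminus_at_bot
    by (intro filterlim_tendsto_pos_mult_at_top[OF tendsto_const]) auto
  then have "filterlim (\<lambda>y. 1 + 2 * (- (k' y / k y))) at_top (at_right 0)"
    by (rule filterlim_tendsto_add_at_top[OF tendsto_const])
  from filterlim_compose[OF this ln_shift_at_0]
  have "((\<lambda>\<tau>. (\<tau> + 1) / (1 + 2 * (- (k' (ln (\<tau> + 1)) / k (ln (\<tau> + 1)))))) \<longlongrightarrow> 0) (at_right 0)"
    by (rule real_tendsto_divide_at_top[rotated]) (auto intro!: tendsto_eq_intros)
  then show "((\<lambda>\<tau>. - pressure_factor \<tau> / pressure_factor' \<tau>) \<longlongrightarrow> 0) (at_right 0)"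
  proof (rule filterlim_mono_eventually)
    show "eventually (\<lambda>\<tau>. (\<tau> + 1) / (1 + 2 * (- (k' (ln (\<tau> + 1)) / k (ln (\<tau> + 1))))) =
        - pressure_factor \<tau> / pressure_factor' \<tau>) (at_right 0)"
      using pos
    proof eventually_elim
      case (elim \<tau>)
      define a b where "a = k (ln (\<tau> + 1))" and "b = k' (ln (\<tau> + 1))"
      have ab: "a > 0" "b < 0" using elim k_pos k'_neg by (auto simp: a_def b_def)
      have "1 + 2 * - (b / a) = (a - 2 * b) / a" using ab by (simp add: field_simps)
      then have "(\<tau> + 1) / (1 + 2 * - (b / a)) = (\<tau> + 1) * a / (a - 2 * b)" by simp
      also have "\<dots> = - (a\<^sup>2 / (\<tau> + 1)) / ((2 * a * b - a\<^sup>2) / (\<tau> + 1)\<^sup>2)"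
      proof -
        have *: "s * a / u = - (a\<^sup>2 / s) / (- (a * u) / s\<^sup>2)" if "s > 0" "u > 0" for s u
          using that ab by (simp add: field_simps power2_eq_square)
        have "2 * a * b - a\<^sup>2 = - (a * (a - 2 * b))" by (simp add: power2_eq_square algebra_simps)
        then show ?thesis using *[of "\<tau> + 1" "a - 2 * b"] ab elim by simp
      qed
      finally show ?case by (simp add: pressure_factor_def pressure_factor'_def a_def b_def)
    qed
  qed auto
qed

text \<open>Dropping the positive term \<open>- 2 * k * k'\<close> under the root bounds the
  derivative of \<open>G\<close> below by \<open>k (ln (\<tau> + 1)) / (\<tau> + 1)\<close>, the
  derivative of an antiderivative of \<open>k\<close> taken at \<open>ln (\<tau> + 1)\<close>. That
  composition diverges because the integral of \<open>k\<close> does.\<close>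

lemma sound_integral_at_top:
  assumes G: "\<And>\<tau>. \<tau> > 0 \<Longrightarrow> (G has_real_derivative sqrt (- pressure_factor' \<tau>)) (at \<tau>)"
  shows "filterlim G at_top at_top"
proof -
  obtain J where J: "\<And>y. y > 0 \<Longrightarrow> (J has_real_derivative k y) (at y)"
    using antiderivative_pos[OF k_cont] by blast
  have "filterlim J at_top at_top"
    by (rule antiderivative_at_top[OF k_cont k_pos J k_not_integrable])
  then have "filterlim (\<lambda>\<tau>. J (ln (\<tau> + 1))) at_top at_top"
    by (rule filterlim_compose[OF _ ln_shift_at_top])
  then have top: "filterlim (\<lambda>\<tau>. (G 1 - J (ln (1 + 1))) + J (ln (\<tau> + 1))) at_top at_top"
    by (rule filterlim_tendsto_add_at_top[OF tendsto_const])
  have "G 1 - J (ln (1 + 1)) \<le> G \<tau> - J (ln (\<tau> + 1))" if "\<tau> \<ge> 1" for \<tau>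
  proof (rule DERIV_nonneg_imp_nondecreasing[OF that])
    fix t :: real assume "1 \<le> t"
    then have t: "t > 0" by simp
    define a b where "a = k (ln (t + 1))" and "b = k' (ln (t + 1))"
    have ab: "a > 0" "b < 0" using t k_pos k'_neg by (auto simp: a_def b_def)
    have "a / (t + 1) = sqrt (a\<^sup>2 / (t + 1)\<^sup>2)" using ab t by (simp add: real_sqrt_divide)
    also have "\<dots> \<le> sqrt (- ((2 * a * b - a\<^sup>2) / (t + 1)\<^sup>2))"
      unfolding minus_divide_left using ab by (intro real_sqrt_le_mono divide_right_mono) (auto simp: mult_pos_neg less_imp_le)
    finally have "a / (t + 1) \<le> sqrt (- pressure_factor' t)"
      by (simp add: pressure_factor'_def a_def b_def)
    moreover have "((\<lambda>\<tau>. G \<tau> - J (ln (\<tau> + 1))) has_real_derivative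
        sqrt (- pressure_factor' t) - a * (1 / (t + 1))) (at t)"
      unfolding a_def
      by (intro DERIV_diff G DERIV_chain2[OF J[OF ln_shift_pos] ln_shift_deriv] t)
    ultimately show "\<exists>d. ((\<lambda>\<tau>. G \<tau> - J (ln (\<tau> + 1))) has_real_derivative d) (at t) \<and> 0 \<le> d"
      by (intro exI conjI) auto
  qed
  then show ?thesis
    by (intro filterlim_at_top_mono[OF top] eventually_mono[OF eventually_ge_at_top[of 1]]) fastforce
qed

end

theorem theorem4p1:
  fixes f k :: "real \<Rightarrow> real" and E :: "real \<Rightarrow> real \<Rightarrow> real"
  assumes E_eq: "\<And>\<tau> S. \<tau> > 0 \<Longrightarrow> E \<tau> S = f S * (LBINT y:{ln (\<tau> + 1)..}. (k y)\<^sup>2)"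
    and f_C2: "C2_on f UNIV"
    and f_pos: "\<And>S. f S > 0"
    and f'_pos: "\<And>S. deriv f S > 0"
    and f''_nonneg: "\<And>S. deriv (deriv f) S \<ge> 0"
    and f_at_top: "filterlim f at_top at_top"
    and f_at_bot: "(f \<longlongrightarrow> 0) at_bot"
    and k_C2: "C2_on k {0<..}"
    and k_pos: "\<And>y. y > 0 \<Longrightarrow> k y > 0"
    and k'_neg: "\<And>y. y > 0 \<Longrightarrow> deriv k y < 0"
    and k''_pos: "\<And>y. y > 0 \<Longrightarrow> deriv (deriv k) y > 0"
    and k_sq_integrable: "set_integrable lborel {1..} (\<lambda>y. (k y)\<^sup>2)"
    and k_not_integrable: "(\<integral>\<^sup>+ y\<in>{1..}. ennreal (k y) \<partial>lborel) = \<infinity>"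
    and k_at_0: "filterlim k at_top (at_right 0)"
    and k_log_deriv_at_0: "filterlim (\<lambda>y. deriv k y / k y) at_bot (at_right 0)"
  shows "(\<forall>Ul Ur. dens Ul > 0 \<and> dens Ur > 0 \<longrightarrow>
            (\<exists>!sol. riemann_solution E Ul Ur sol) \<and>
            (\<forall>sol. riemann_solution E Ul Ur sol \<longrightarrow> \<not> contains_vacuum sol)) \<and>
         plane_C2_on E ({0<..} \<times> UNIV) \<and>
         (\<forall>\<tau> S. \<tau> > 0 \<longrightarrow> pressure E \<tau> S > 0 \<and> temperature E \<tau> S \<ge> 0) \<and>
         (\<forall>S. ((\<lambda>\<tau>. E \<tau> S) \<longlongrightarrow> 0) at_top) \<and>
         (\<forall>\<tau> S. \<tau> > 0 \<longrightarrow> E \<tau> S > 0) \<and>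
         (\<forall>\<tau> S. \<tau> > 0 \<longrightarrow>
            partial1 (partial1 E) \<tau> S = - partial1 (pressure E) \<tau> S \<and>
            partial1 (partial1 E) \<tau> S > 0 \<and>
            partial2 (partial2 E) \<tau> S = partial2 (temperature E) \<tau> S \<and>
            partial2 (partial2 E) \<tau> S \<ge> 0) \<and>
         (\<forall>S. set_integrable lborel {1..} (\<lambda>\<tau>. pressure E \<tau> S)) \<and>
         (\<forall>\<tau> S. \<tau> > 0 \<longrightarrow> set_integrable lborel {\<tau>..} (\<lambda>t. pressure E t S) \<and>
            E \<tau> S = (LBINT t:{\<tau>..}. pressure E t S))"
proof -
  note f = C2_on_derivs[OF f_C2 open_UNIV] and k = C2_on_derivs[OF k_C2 open_greaterThan]
  interpret gas_kernel k "deriv k" "deriv (deriv k)"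
    using k k_pos k'_neg k''_pos k_sq_integrable k_not_integrable k_at_0 k_log_deriv_at_0
    by unfold_locales auto
  have E: "E \<tau> S = f S * energy_factor \<tau>" if "\<tau> > 0" for \<tau> S
    using E_eq[OF that] by (simp add: energy_factor_def tail_def)
  have f_less: "f s < f t" if "s < t" for s t
    using that f(1) f'_pos by (intro DERIV_pos_imp_increasing[of s t f]) auto
  have f_cont: "continuous_on UNIV f"
    using f(1) by (intro continuous_at_imp_continuous_on) (auto intro: DERIV_isCont)
  \<comment> \<open>The limits 0 and infinity place \<open>c\<close> between two values of the
    continuous \<open>f\<close>.\<close>
  have f_onto: "\<exists>S. f S = c" if "c > 0" for c
  proof -
    have "eventually (\<lambda>S. f S < c) at_bot" using order_tendstoD(2)[OF f_at_bot that] .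
    then obtain s where s: "f s < c" using eventually_happens' trivial_limit_at_bot_linorder by blast
    have "eventually (\<lambda>S. f S > c) at_top" using f_at_top unfolding filterlim_at_top_dense by blast
    then obtain t where t: "s < t" "f t > c" by (rule at_top_witness)
    then show ?thesis
      using IVT'[of f s c t] s continuous_on_subset[OF f_cont] by auto
  qed
  have "continuous_on {0<..} (\<lambda>\<tau>. sqrt (- pressure_factor' \<tau>))"
    by (intro continuous_intros pressure_factor'_cont)
  \<comment> \<open>The additive constant is immaterial: only differences of \<open>G\<close> enter
    rarefactions and wave curves.\<close>
  then obtain G where G: "\<And>\<tau>. \<tau> > 0 \<Longrightarrow> (G has_real_derivative sqrt (- pressure_factor' \<tau>)) (at \<tau>)"
    using antiderivative_pos by blast
  have G_top: "filterlim G at_top at_top"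
    by (rule sound_integral_at_top) (rule G)
  interpret separable_gas E f energy_factor pressure_factor pressure_factor' G
  proof
    show "inj f" using f_less by (intro strict_mono_imp_inj_on[OF strict_monoI])
  qed (fact E f_pos f_onto energy_factor_pos energy_factor_deriv pressure_factor_pos pressure_factor_deriv
      pressure_factor'_neg pressure_factor'_cont factor_shock_monotone pressure_factor_at_top
      energy_pressure_ratio_at_0 G G_top)+
  have neg_deriv: "((\<lambda>t. - pressure_factor t) has_real_derivative - pressure_factor' \<tau>) (at \<tau>)"
    if "\<tau> > 0" for \<tau>
    using pressure_factor_deriv[OF that] by (rule DERIV_minus)
  note E' = E f(1)[OF UNIV_I] energy_factor_deriv
  have E1: "partial1 E \<tau> S = f S * - pressure_factor \<tau>" if "\<tau> > 0" for \<tau> S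
    by (rule partial1_product[OF E' that])
  have E2: "partial2 E \<tau> S = deriv f S * energy_factor \<tau>" if "\<tau> > 0" for \<tau> S
    by (rule partial2_product[OF E' that])
  note E1' = E1 f(1)[OF UNIV_I] neg_deriv and E2' = E2 f(2)[OF UNIV_I] energy_factor_deriv
  have f'_cont: "continuous_on UNIV (deriv f)"
    using f(2) by (intro continuous_at_imp_continuous_on) (auto intro: DERIV_isCont)
  have neg_cont: "continuous_on {0<..} (\<lambda>t. - pressure_factor t)"
    by (intro continuous_intros q_cont)
  \<comment> \<open>\<open>E\<close> and both first partials are products of a function of entropy
    and one of volume, so the product rule is applied three times.\<close>
  have C2: "plane_C2_on E ({0<..} \<times> UNIV)"
    unfolding plane_C2_on_def
    using plane_C1_on_product[OF E' f'_cont neg_cont] plane_C1_on_product[OF E2' f(3) neg_cont]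
      plane_C1_on_product[OF E1' f'_cont continuous_on_minus[OF pressure_factor'_cont]] by blast
  have p: "pressure E \<tau> S = f S * pressure_factor \<tau>" if "\<tau> > 0" for \<tau> S
    using that by (rule pressure_eq)
  have E11: "partial1 (partial1 E) \<tau> S = f S * - pressure_factor' \<tau>" if "\<tau> > 0" for \<tau> S
    by (rule partial1_product[OF E1' that])
  have p1: "partial1 (pressure E) \<tau> S = f S * pressure_factor' \<tau>" if "\<tau> > 0" for \<tau> S
    by (rule partial1_product[OF p f(1)[OF UNIV_I] pressure_factor_deriv that])
  have E22: "partial2 (partial2 E) \<tau> S = deriv (deriv f) S * energy_factor \<tau>" if "\<tau> > 0" for \<tau> S
    by (rule partial2_product[OF E2' that])
  have "((\<lambda>\<tau>. f S * energy_factor \<tau>) \<longlongrightarrow> f S * 0) at_top" for S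
    by (intro tendsto_intros energy_factor_at_top)
  then have E_top: "((\<lambda>\<tau>. E \<tau> S) \<longlongrightarrow> 0) at_top" for S
    by (rule filterlim_mono_eventually)
       (auto intro!: eventually_mono[OF eventually_gt_at_top[of 0]] simp: E)
  \<comment> \<open>An antiderivative of the pressure in volume is \<open>- E\<close>, with limit 0
    at infinity; \<open>0 - - E \<tau> S\<close> is its limit minus its value at
    \<open>\<tau>\<close>.\<close>
  have int: "set_integrable lborel {\<tau>..} (\<lambda>t. pressure E t S)"
    "(LBINT t:{\<tau>..}. pressure E t S) = 0 - - E \<tau> S" if \<tau>: "\<tau> > 0" for \<tau> S
  proof -
    have "continuous_on {\<tau>..} (\<lambda>t. pressure E t S)"
      by (rule continuous_on_eq[of _ "\<lambda>t. f S * pressure_factor t"])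
         (use \<tau> p in \<open>auto intro!: continuous_intros continuous_on_subset[OF q_cont]\<close>)
    moreover have "((\<lambda>t. - E t S) has_real_derivative pressure E t S) (at t)" if "\<tau> \<le> t" for t
    proof (rule has_field_derivative_transform_within_open[of "\<lambda>t. - (f S * energy_factor t)" _ _ "{0<..}"])
      show "((\<lambda>t. - (f S * energy_factor t)) has_real_derivative pressure E t S) (at t)"
        using DERIV_minus[OF DERIV_cmult[OF energy_factor_deriv[of t], of "f S"]] that \<tau> by (simp add: p)
    qed (use that \<tau> E in auto)
    moreover have "0 \<le> pressure E t S" if "\<tau> \<le> t" for t
      using that \<tau> f_pos[of S] pressure_factor_pos[of t] by (simp add: p)
    moreover have "((\<lambda>t. - E t S) \<longlongrightarrow> 0) at_top"
      using tendsto_minus[OF E_top] by simp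
    ultimately show "set_integrable lborel {\<tau>..} (\<lambda>t. pressure E t S)"
      "(LBINT t:{\<tau>..}. pressure E t S) = 0 - - E \<tau> S"
      using has_bochner_integral_FTC_atLeast[of \<tau> "\<lambda>t. pressure E t S" "\<lambda>t. - E t S" 0] by auto
  qed
  have T: "temperature E = partial2 E" by (simp add: temperature_def[abs_def])
  show ?thesis
    using riemann_solution_unique riemann_solution_no_vacuum C2 E_top int
      f_pos f'_pos f''_nonneg energy_factor_pos pressure_factor_pos pressure_factor'_neg
    by (simp add: p E E11 p1 E22 E2 T less_imp_le mult_pos_neg)
qed

end
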